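(* Let $\alpha\in\mathbb{D}$, $\beta\in\mathbb{T}$, $\beta\neq1$, $\Psi_\alpha(z)=\frac{\alpha-z}{1-\overline{\alpha}z}$, $r_\beta(z)=\beta z$, and $\varphi=\Psi_\alpha\circ r_\beta\circ\Psi_\alpha$. Assume $\varphi$ is aperiodic, i.e. $\varphi_n\neq\mathrm{Id}$ for all $n\in\mathbb{N}$ where $\varphi_n=\varphi\circ\cdots\circ\varphi$ ($n$ times). Let $m\in\mathrm{Hol}(\mathbb{D})$, $m\not\equiv0$, and $T:\mathrm{Hol}(\mathbb{D})\to\mathrm{Hol}(\mathbb{D})$, $Tf=m\cdot(f\circ\varphi)$. (a) If $m(z)\neq0$ for all $z\in\mathbb{D}$, then $\sigma_W(T)=\{\lambda\in\mathbb{C}:|\lambda|=|m(\alpha)|\}$. (b) If there exists $z_0\in\mathbb{D}$ with $m(z_0)=0$, then there exists $0<R\leq\infty$ such that $\sigma_W(T)=\{\lambda\in\mathbb{C}:|\lambda|\leq R\}$ if $R<\infty$ and $\sigma_W(T)=\mathbb{C}$ otherwise.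
   Context: $\mathbb{D}$ is the open unit disc, $\mathbb{T}$ the unit circle, $\mathrm{Hol}(\mathbb{D})$ the Fréchet space of holomorphic functions on $\mathbb{D}$ with seminorms $\|f\|_{A(r\mathbb{D})}=\sup_{|z|\leq r}|f(z)|$, $0<r<1$. For a continuous linear $T$ on $\mathrm{Hol}(\mathbb{D})$, $\rho(T)$ is the set of $\lambda$ with $\lambda\mathrm{Id}-T$ bijective and $R_\lambda=(\lambda\mathrm{Id}-T)^{-1}$. The Waelbroeck resolvent set $\rho_W(T)$ is the set of $\lambda\in\rho(T)$ for which there is $\delta>0$ with $\overline{D}(\lambda,\delta)\subset\rho(T)$ and $\sup_{|\mu-\lambda|\leq\delta}\|R_\mu f\|_{A(r\mathbb{D})}<\infty$ for all $f\in\mathrm{Hol}(\mathbb{D})$, $0<r<1$; $\sigma_W(T)=\mathbb{C}\setminus\rho_W(T)$. *)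

theory Defs
  imports "HOL-Analysis.Analysis"
begin

text \<open>Elements of Hol(D) are represented by functions complex => complex that are
holomorphic on the unit disc; two such functions are identified when they agree on the disc.
An operator T acts on such functions.\<close>

definition hol_disc :: "(complex \<Rightarrow> complex) set" where
  "hol_disc = {f. f holomorphic_on ball 0 1}"

definition resolvent_set :: "((complex \<Rightarrow> complex) \<Rightarrow> (complex \<Rightarrow> complex)) \<Rightarrow> complex set" where
  "resolvent_set T = {l.
     (\<forall>g\<in>hol_disc. \<exists>f\<in>hol_disc. \<forall>z\<in>ball 0 1. l * f z - T f z = g z) \<and>
     (\<forall>f1\<in>hol_disc. \<forall>f2\<in>hol_disc.
        (\<forall>z\<in>ball 0 1. l * f1 z - T f1 z = l * f2 z - T f2 z) \<longrightarrow>
        (\<forall>z\<in>ball 0 1. f1 z = f2 z))}"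

text \<open>Waelbroeck resolvent set: R_mu g is the (unique on the disc) f in Hol(D) with
(mu Id - T) f = g; the bound is required for every such f.\<close>
definition waelbroeck_resolvent_set :: "((complex \<Rightarrow> complex) \<Rightarrow> (complex \<Rightarrow> complex)) \<Rightarrow> complex set" where
  "waelbroeck_resolvent_set T = {l \<in> resolvent_set T.
     \<exists>\<delta>>0. cball l \<delta> \<subseteq> resolvent_set T \<and>
       (\<forall>g\<in>hol_disc. \<forall>r. 0 < r \<and> r < 1 \<longrightarrow>
          (\<exists>C. \<forall>\<mu>\<in>cball l \<delta>. \<forall>f\<in>hol_disc.
              (\<forall>z\<in>ball 0 1. \<mu> * f z - T f z = g z) \<longrightarrow>
              (\<forall>z. norm z \<le> r \<longrightarrow> norm (f z) \<le> C)))}"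

definition waelbroeck_spectrum :: "((complex \<Rightarrow> complex) \<Rightarrow> (complex \<Rightarrow> complex)) \<Rightarrow> complex set" where
  "waelbroeck_spectrum T = UNIV - waelbroeck_resolvent_set T"

definition Psi :: "complex \<Rightarrow> complex \<Rightarrow> complex" where
  "Psi \<alpha> z = (\<alpha> - z) / (1 - cnj \<alpha> * z)"

definition weighted_comp :: "(complex \<Rightarrow> complex) \<Rightarrow> (complex \<Rightarrow> complex) \<Rightarrow> (complex \<Rightarrow> complex) \<Rightarrow> (complex \<Rightarrow> complex)" where
  "weighted_comp m \<phi> f = (\<lambda>z. m z * f (\<phi> z))"

end

theory Submission
  imports Defs "HOL-Complex_Analysis.Complex_Analysis"
begin

text \<open>Conjugation by \<open>Psi \<alpha>\<close> turns \<open>T\<close> into \<open>T f z = M z * f (\<beta> * z)\<close> with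
  \<open>M 0 = m \<alpha>\<close>. In Taylor coefficients \<open>T\<close> is lower triangular with diagonal \<open>M 0 * \<beta> ^ n\<close>; these
  values are never in the resolvent set and are dense in the circle of radius \<open>norm (M 0)\<close>.
  Multiplication by \<open>z\<close> makes the Waelbroeck resolvent set, off that circle, invariant under rotation
  by \<open>\<beta>\<close>, so with a point it contains the whole circle through it. The Taylor coefficients of
  the resolvent are rational in \<open>\<mu>\<close> with poles only at the diagonal values, so by the maximum
  principle solvability with bounds on a circle outside (inside) the critical one propagates to its
  exterior (interior). Inside, this reaches \<open>\<mu> = 0\<close>, which is impossible if \<open>M\<close> has a zero;
  hence the spectrum is then a disc or the plane. If \<open>M\<close> has no zero, writing \<open>M\<close> as an
  exponential and using unique ergodicity of the rotation, both Neumann series converge.\<close>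

text \<open>A pair \<open>(a, b)\<close> stands for the operator \<open>a - b T\<close>: \<open>(\<mu>, 1)\<close> gives the resolvent at \<open>\<mu>\<close>,
  and \<open>(1, w)\<close> its rescaling with \<open>w = 1 / \<mu>\<close>, which is regular at infinity.\<close>

definition unif_solvable ::
    "(complex \<Rightarrow> complex) \<Rightarrow> complex \<Rightarrow> (complex \<times> complex) set \<Rightarrow> bool" where
  "unif_solvable m \<beta> P \<longleftrightarrow> (\<forall>g r. g holomorphic_on ball 0 1 \<longrightarrow> 0 < r \<longrightarrow> r < 1 \<longrightarrow>
     (\<exists>C. \<forall>(a, b)\<in>P. \<exists>f. f holomorphic_on ball 0 1 \<and>
        (\<forall>z\<in>ball 0 1. a * f z - b * (m z * f (\<beta> * z)) = g z) \<and>
        (\<forall>z. norm z \<le> r \<longrightarrow> norm (f z) \<le> C)))"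

section \<open>Closure properties of uniform solvability\<close>

lemma unif_solvableD:
  assumes "unif_solvable m \<beta> P" "g holomorphic_on ball 0 1" "0 < r" "r < 1"
  obtains C where "\<And>a b. (a, b) \<in> P \<Longrightarrow> \<exists>f. f holomorphic_on ball 0 1 \<and>
      (\<forall>z\<in>ball 0 1. a * f z - b * (m z * f (\<beta> * z)) = g z) \<and>
      (\<forall>z. norm z \<le> r \<longrightarrow> norm (f z) \<le> C)"
proof -
  from assms obtain C where "\<forall>(a, b)\<in>P. \<exists>f. f holomorphic_on ball 0 1 \<and>
      (\<forall>z\<in>ball 0 1. a * f z - b * (m z * f (\<beta> * z)) = g z) \<and>
      (\<forall>z. norm z \<le> r \<longrightarrow> norm (f z) \<le> C)"
    unfolding unif_solvable_def by blast
  then show ?thesis by (intro that[of C]) blast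
qed

lemma unif_solvableI:
  assumes "\<And>g r. g holomorphic_on ball 0 1 \<Longrightarrow> 0 < r \<Longrightarrow> r < 1 \<Longrightarrow>
    \<exists>C. \<forall>a b. (a, b) \<in> P \<longrightarrow> (\<exists>f. f holomorphic_on ball 0 1 \<and>
      (\<forall>z\<in>ball 0 1. a * f z - b * (m z * f (\<beta> * z)) = g z) \<and>
      (\<forall>z. norm z \<le> r \<longrightarrow> norm (f z) \<le> C))"
  shows "unif_solvable m \<beta> P"
  unfolding unif_solvable_def
proof (intro allI impI)
  fix g and r :: real assume "g holomorphic_on ball 0 1" "0 < r" "r < 1"
  from assms[OF this] obtain C where "\<And>a b. (a, b) \<in> P \<Longrightarrow> \<exists>f. f holomorphic_on ball 0 1 \<and>
      (\<forall>z\<in>ball 0 1. a * f z - b * (m z * f (\<beta> * z)) = g z) \<and>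
      (\<forall>z. norm z \<le> r \<longrightarrow> norm (f z) \<le> C)" by blast
  then show "\<exists>C. \<forall>(a, b)\<in>P. \<exists>f. f holomorphic_on ball 0 1 \<and>
        (\<forall>z\<in>ball 0 1. a * f z - b * (m z * f (\<beta> * z)) = g z) \<and>
        (\<forall>z. norm z \<le> r \<longrightarrow> norm (f z) \<le> C)" by (intro exI[of _ C]) blast
qed

lemma unif_solvable_mono: "unif_solvable m \<beta> P \<Longrightarrow> Q \<subseteq> P \<Longrightarrow> unif_solvable m \<beta> Q"
  unfolding unif_solvable_def by (meson subsetD)

text \<open>The larger of the two bounds serves both sets. Through finite unions this allows a
  circle to be covered by finitely many small discs.\<close>

lemma unif_solvable_Un:
  assumes "unif_solvable m \<beta> P" "unif_solvable m \<beta> Q"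
  shows "unif_solvable m \<beta> (P \<union> Q)"
proof (rule unif_solvableI)
  fix g and r :: real assume g: "g holomorphic_on ball 0 1" and r: "0 < r" "r < 1"
  let ?sol = "\<lambda>a b C. \<exists>f. f holomorphic_on ball 0 1 \<and>
      (\<forall>z\<in>ball 0 1. a * f z - b * (m z * f (\<beta> * z)) = g z) \<and>
      (\<forall>z. norm z \<le> r \<longrightarrow> norm (f z) \<le> C)"
  obtain C where C: "\<And>a b. (a, b) \<in> P \<Longrightarrow> ?sol a b C"
    using unif_solvableD[OF assms(1) g r] by blast
  obtain D where D: "\<And>a b. (a, b) \<in> Q \<Longrightarrow> ?sol a b D"
    using unif_solvableD[OF assms(2) g r] by blast
  have mono: "?sol a b E \<Longrightarrow> E \<le> max C D \<Longrightarrow> ?sol a b (max C D)" for a b E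
    by (meson order_trans)
  show "\<exists>C. \<forall>a b. (a, b) \<in> P \<union> Q \<longrightarrow> ?sol a b C"
    using mono[OF C] mono[OF D] by (intro exI[of _ "max C D"]) auto
qed

lemma unif_solvable_UN:
  assumes "finite I" "\<And>i. i \<in> I \<Longrightarrow> unif_solvable m \<beta> (P i)"
  shows "unif_solvable m \<beta> (\<Union>i\<in>I. P i)"
  using assms
proof (induction I rule: finite_induct)
  case empty
  show ?case by (simp add: unif_solvable_def)
next
  case (insert i I)
  then show ?case by (simp add: unif_solvable_Un)
qed

text \<open>If \<open>f\<close> solves the equation of the pair \<open>(c * a, c * b)\<close>, then
  \<open>c * f\<close> solves that of \<open>(a, b)\<close>; the bound on \<open>c\<close> keeps the
  estimate uniform. This is the passage between \<open>(\<mu>, 1)\<close> and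
  \<open>(1, 1 / \<mu>)\<close>.\<close>

lemma unif_solvable_scale:
  assumes "unif_solvable m \<beta> P"
    and Q: "\<And>a b. (a, b) \<in> Q \<Longrightarrow> \<exists>c. c \<noteq> 0 \<and> (c * a, c * b) \<in> P \<and> norm c \<le> B"
  shows "unif_solvable m \<beta> Q"
proof (rule unif_solvableI)
  fix g and r :: real assume g: "g holomorphic_on ball 0 1" and r: "0 < r" "r < 1"
  obtain C where C: "\<And>a b. (a, b) \<in> P \<Longrightarrow> \<exists>f. f holomorphic_on ball 0 1 \<and>
      (\<forall>z\<in>ball 0 1. a * f z - b * (m z * f (\<beta> * z)) = g z) \<and>
      (\<forall>z. norm z \<le> r \<longrightarrow> norm (f z) \<le> C)"
    using unif_solvableD[OF assms(1) g r] by blast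
  have "\<exists>f. f holomorphic_on ball 0 1 \<and>
      (\<forall>z\<in>ball 0 1. a * f z - b * (m z * f (\<beta> * z)) = g z) \<and>
      (\<forall>z. norm z \<le> r \<longrightarrow> norm (f z) \<le> B * C)" if ab: "(a, b) \<in> Q" for a b
  proof -
    obtain c where c: "c \<noteq> 0" "(c * a, c * b) \<in> P" "norm c \<le> B" using Q ab by blast
    obtain f where f: "f holomorphic_on ball 0 1"
      "\<forall>z\<in>ball 0 1. c * a * f z - c * b * (m z * f (\<beta> * z)) = g z"
      "\<forall>z. norm z \<le> r \<longrightarrow> norm (f z) \<le> C" using C[OF c(2)] by blast
    have "0 \<le> B" using c(3) norm_ge_zero order_trans by blast
    then have "norm (c * f z) \<le> B * C" if "norm z \<le> r" for z
      using f(3) c(3) that by (auto simp: norm_mult intro!: mult_mono)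
    moreover have "(\<lambda>z. c * f z) holomorphic_on ball 0 1"
      using f(1) by (intro holomorphic_intros)
    ultimately show ?thesis
      using f(2) by (intro exI[of _ "\<lambda>z. c * f z"]) (auto simp: algebra_simps)
  qed
  then show "\<exists>C. \<forall>a b. (a, b) \<in> Q \<longrightarrow> (\<exists>f. f holomorphic_on ball 0 1 \<and>
      (\<forall>z\<in>ball 0 1. a * f z - b * (m z * f (\<beta> * z)) = g z) \<and>
      (\<forall>z. norm z \<le> r \<longrightarrow> norm (f z) \<le> C))"
    by blast
qed

section \<open>Taylor coefficients of solutions\<close>

lemma holomorphic_on_rotate:
  assumes "f holomorphic_on ball 0 1" "norm \<beta> = 1"
  shows "(\<lambda>z. f (\<beta> * z)) holomorphic_on ball 0 1"
  using assms
  by (intro holomorphic_on_compose_gen[OF _ assms(1), unfolded o_def])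
     (auto intro!: holomorphic_intros simp: norm_mult)

lemma has_fps_expansion_disc:
  "f holomorphic_on ball 0 1 \<Longrightarrow> f has_fps_expansion fps_expansion f 0"
  by (rule has_fps_expansion_fps_expansion[of "ball 0 1"]) auto

text \<open>Coefficient \<open>n\<close> of the image involves only the coefficients of
  \<open>f\<close> up to \<open>n\<close>: the operator is lower triangular, and the term
  \<open>i = n\<close> of the sum yields the diagonal entry
  \<open>a - b * M 0 * \<beta> ^ n\<close>.\<close>

lemma has_fps_expansion_transfer_op:
  fixes f m :: "complex \<Rightarrow> complex"
  assumes f: "f has_fps_expansion F" and m: "m has_fps_expansion M"
  shows "(\<lambda>z. a * f z - b * (m z * f (\<beta> * z))) has_fps_expansion
    Abs_fps (\<lambda>n. a * fps_nth F n - b * (\<Sum>i\<le>n. \<beta> ^ i * fps_nth M (n - i) * fps_nth F i))"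
proof -
  have "(\<lambda>z. f (\<beta> * z)) has_fps_expansion fps_compose F (fps_const \<beta> * fps_X)"
    using has_fps_expansion_compose[OF f, of "\<lambda>z. \<beta> * z" "fps_const \<beta> * fps_X"]
    by (simp add: o_def has_fps_expansion_cmult_left has_fps_expansion_fps_X)
  then have "(\<lambda>z. a * f z - b * (f (\<beta> * z) * m z)) has_fps_expansion
      fps_const a * F - fps_const b * (fps_compose F (fps_const \<beta> * fps_X) * M)"
    using f m by (intro fps_expansion_intros)
  moreover have "fps_const a * F - fps_const b * (fps_compose F (fps_const \<beta> * fps_X) * M) =
    Abs_fps (\<lambda>n. a * fps_nth F n - b * (\<Sum>i\<le>n. \<beta> ^ i * fps_nth M (n - i) * fps_nth F i))"
  proof (rule fps_ext)
    fix n
    have "fps_nth (fps_compose F (fps_const \<beta> * fps_X) * M) n =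
        (\<Sum>i\<le>n. \<beta> ^ i * fps_nth M (n - i) * fps_nth F i)"
      unfolding fps_mult_nth by (auto simp: fps_compose_linear atLeast0AtMost intro!: sum.cong)
    then show "fps_nth (fps_const a * F
          - fps_const b * (fps_compose F (fps_const \<beta> * fps_X) * M)) n
        = fps_nth (Abs_fps (\<lambda>n. a * fps_nth F n
            - b * (\<Sum>i\<le>n. \<beta> ^ i * fps_nth M (n - i) * fps_nth F i))) n"
      by simp
  qed
  ultimately show ?thesis by (simp add: mult.commute)
qed

lemma transfer_op_coeffs:
  assumes "f holomorphic_on ball 0 1" "g holomorphic_on ball 0 1" "m holomorphic_on ball 0 1"
    and eq: "\<And>z. z \<in> ball 0 1 \<Longrightarrow> a * f z - b * (m z * f (\<beta> * z)) = g z"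
  shows "a * fps_nth (fps_expansion f 0) n - b * (\<Sum>i\<le>n. \<beta> ^ i *
      fps_nth (fps_expansion m 0) (n - i) * fps_nth (fps_expansion f 0) i)
    = fps_nth (fps_expansion g 0) n"
proof -
  let ?H = "Abs_fps (\<lambda>n. a * fps_nth (fps_expansion f 0) n - b * (\<Sum>i\<le>n. \<beta> ^ i *
      fps_nth (fps_expansion m 0) (n - i) * fps_nth (fps_expansion f 0) i))"
  have "(\<lambda>z. a * f z - b * (m z * f (\<beta> * z))) has_fps_expansion ?H"
    using assms by (intro has_fps_expansion_transfer_op has_fps_expansion_disc)
  moreover have "\<forall>\<^sub>F z in nhds 0. a * f z - b * (m z * f (\<beta> * z)) = g z"
    using eventually_nhds_in_open[of "ball 0 1" "0::complex"]
    by (auto elim!: eventually_mono simp: eq)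
  ultimately have "g has_fps_expansion ?H"
    by (subst (asm) has_fps_expansion_cong) auto
  then have "fps_expansion g 0 = ?H"
    using fps_expansion_unique_complex has_fps_expansion_disc assms(2) by blast
  then show ?thesis by simp
qed

text \<open>Forward substitution in the triangular system, with \<open>M\<close> and
  \<open>G\<close> the coefficients of the weight and of the right-hand side. Where the diagonal
  entry vanishes the quotient is 0 by convention and carries no meaning.\<close>

fun sol_coeff :: "complex \<Rightarrow> (nat \<Rightarrow> complex) \<Rightarrow> (nat \<Rightarrow> complex) \<Rightarrow> complex \<Rightarrow> complex \<Rightarrow> nat \<Rightarrow> complex"
  where "sol_coeff \<beta> M G a b n =
    (G n + b * (\<Sum>i<n. \<beta> ^ i * M (n - i) * sol_coeff \<beta> M G a b i)) / (a - b * M 0 * \<beta> ^ n)"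

declare sol_coeff.simps [simp del]

lemma sol_coeff_eq:
  assumes "a - b * M 0 * \<beta> ^ n \<noteq> 0"
  shows "a * sol_coeff \<beta> M G a b n
      - b * (\<Sum>i\<le>n. \<beta> ^ i * M (n - i) * sol_coeff \<beta> M G a b i) = G n"
proof -
  have "(a - b * M 0 * \<beta> ^ n) * sol_coeff \<beta> M G a b n =
      G n + b * (\<Sum>i<n. \<beta> ^ i * M (n - i) * sol_coeff \<beta> M G a b i)"
    by (subst sol_coeff.simps) (use assms in simp)
  then show ?thesis
    by (simp add: algebra_simps flip: lessThan_Suc_atMost)
qed

lemma sol_coeff_unique:
  assumes nz: "\<And>n. a - b * M 0 * \<beta> ^ n \<noteq> 0"
    and eq: "\<And>n. a * F n - b * (\<Sum>i\<le>n. \<beta> ^ i * M (n - i) * F i) = G n"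
  shows "F n = sol_coeff \<beta> M G a b n"
proof (induction n rule: less_induct)
  case (less n)
  have "(a - b * M 0 * \<beta> ^ n) * F n = G n + b * (\<Sum>i<n. \<beta> ^ i * M (n - i) * F i)"
    using eq[of n] by (simp add: algebra_simps flip: lessThan_Suc_atMost)
  also have "(\<Sum>i<n. \<beta> ^ i * M (n - i) * F i)
      = (\<Sum>i<n. \<beta> ^ i * M (n - i) * sol_coeff \<beta> M G a b i)"
    by (intro sum.cong) (auto simp: less)
  finally show ?case
    by (subst sol_coeff.simps) (use nz[of n] in \<open>simp add: field_simps\<close>)
qed

lemma fps_nth_expansion_solution:
  assumes "f holomorphic_on ball 0 1" "g holomorphic_on ball 0 1" "m holomorphic_on ball 0 1"
    and "\<And>z. z \<in> ball 0 1 \<Longrightarrow> a * f z - b * (m z * f (\<beta> * z)) = g z"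
    and "\<And>n. a - b * m 0 * \<beta> ^ n \<noteq> 0"
  shows "fps_nth (fps_expansion f 0) n = sol_coeff \<beta> (fps_nth (fps_expansion m 0))
    (fps_nth (fps_expansion g 0)) a b n"
  by (rule sol_coeff_unique) (use assms(5) transfer_op_coeffs[OF assms(1-4)] in
      \<open>auto simp: fps_expansion_def\<close>)

text \<open>Off the diagonal values the triangular system determines every Taylor coefficient, and
  these determine the function on the disc.\<close>

lemma solution_unique:
  assumes f: "f1 holomorphic_on ball 0 1" "f2 holomorphic_on ball 0 1"
    and m: "m holomorphic_on ball 0 1" and "norm \<beta> = 1"
    and eq: "\<And>z. z \<in> ball 0 1 \<Longrightarrow>
      a * f1 z - b * (m z * f1 (\<beta> * z)) = a * f2 z - b * (m z * f2 (\<beta> * z))"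
    and nz: "\<And>n. a - b * m 0 * \<beta> ^ n \<noteq> 0"
    and z: "z \<in> ball 0 1"
  shows "f1 z = f2 z"
proof -
  let ?g = "\<lambda>z. a * f1 z - b * (m z * f1 (\<beta> * z))"
  have g: "?g holomorphic_on ball 0 1"
    by (intro holomorphic_intros holomorphic_on_rotate f m \<open>norm \<beta> = 1\<close>)
  have "fps_expansion f1 0 = fps_expansion f2 0"
    using fps_nth_expansion_solution[OF f(1) g m refl nz]
      fps_nth_expansion_solution[OF f(2) g m eq[symmetric] nz] by (simp add: fps_eq_iff)
  moreover have "eval_fps (fps_expansion f 0) z = f z" if "f holomorphic_on ball 0 1" for f
    using eval_fps_expansion'[of f 0 1 z] that z by (simp add: one_ereal_def)
  ultimately show ?thesis using f by metis
qed

text \<open>At a diagonal value the operator is not onto: the monomial of the first resonant degree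
  is missed.\<close>

lemma not_solvable_resonance:
  assumes m: "m holomorphic_on ball 0 1" and eq0: "a - b * m 0 * \<beta> ^ n = 0"
  obtains g where "g holomorphic_on ball 0 1"
    "\<nexists>f. f holomorphic_on ball 0 1 \<and> (\<forall>z\<in>ball 0 1. a * f z - b * (m z * f (\<beta> * z)) = g z)"
proof -
  \<comment> \<open>With the least resonant index the earlier diagonal entries are nonzero, so a
    solution for \<open>z ^ N\<close> has its first \<open>N\<close> coefficients equal to 0, and
    equation \<open>N\<close> then reads \<open>0 = 1\<close>.\<close>
  define N where "N = (LEAST n. a - b * m 0 * \<beta> ^ n = 0)"
  have N: "a - b * m 0 * \<beta> ^ N = 0"
    unfolding N_def by (rule LeastI[of _ n]) (rule eq0)
  have nz: "a - b * m 0 * \<beta> ^ i \<noteq> 0" if "i < N" for i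
    using not_less_Least[OF that[unfolded N_def]] .
  let ?g = "\<lambda>z::complex. z ^ N"
  have g: "?g holomorphic_on ball 0 1" by (intro holomorphic_intros)
  have G: "fps_expansion ?g 0 = fps_X ^ N"
    by (intro fps_expansion_eqI fps_expansion_intros)
  have "False" if f: "f holomorphic_on ball 0 1"
    and eq: "\<And>z. z \<in> ball 0 1 \<Longrightarrow> a * f z - b * (m z * f (\<beta> * z)) = z ^ N" for f
  proof -
    define F where "F = fps_nth (fps_expansion f 0)"
    define M where "M = fps_nth (fps_expansion m 0)"
    have M0: "M 0 = m 0" by (simp add: M_def fps_expansion_def)
    have rel: "(a - b * m 0 * \<beta> ^ n) * F n - b * (\<Sum>i<n. \<beta> ^ i * M (n - i) * F i)
        = (if n = N then 1 else 0)" for n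
      using transfer_op_coeffs[OF f g m eq, where n = n]
      by (simp add: G algebra_simps F_def M_def M0[unfolded M_def] flip: lessThan_Suc_atMost)
    have F0: "F n = 0" if "n < N" for n
      using that
    proof (induction n rule: less_induct)
      case (less n)
      have "(\<Sum>i<n. \<beta> ^ i * M (n - i) * F i) = 0"
        by (rule sum.neutral) (use less in auto)
      then show ?case using rel[of n] nz[of n] less.prems by simp
    qed
    have "(\<Sum>i<N. \<beta> ^ i * M (N - i) * F i) = 0"
      by (rule sum.neutral) (use F0 in auto)
    then show False using rel[of N] N by simp
  qed
  then show ?thesis using that g by blast
qed

text \<open>Bounds for every \<open>r < 1\<close> make the formal solution converge on the whole
  disc. There it solves the equation by analytic continuation from the origin.\<close>

lemma solution_of_coeff_bounds:
  assumes m: "m holomorphic_on ball 0 1" and g: "g holomorphic_on ball 0 1"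
    and "norm \<beta> = 1" and nz: "\<And>n. a - b * m 0 * \<beta> ^ n \<noteq> 0"
    and bd: "\<And>r. 0 < r \<Longrightarrow> r < 1 \<Longrightarrow> \<exists>C. \<forall>n. norm (sol_coeff \<beta> (fps_nth (fps_expansion m 0))
      (fps_nth (fps_expansion g 0)) a b n) \<le> C / r ^ n"
  defines "F \<equiv> Abs_fps (sol_coeff \<beta> (fps_nth (fps_expansion m 0))
      (fps_nth (fps_expansion g 0)) a b)"
  shows "fps_conv_radius F \<ge> 1" "eval_fps F holomorphic_on ball 0 1"
    "\<And>z. z \<in> ball 0 1 \<Longrightarrow> a * eval_fps F z - b * (m z * eval_fps F (\<beta> * z)) = g z"
proof -
  show R: "fps_conv_radius F \<ge> 1"
    unfolding fps_conv_radius_def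
  proof (rule conv_radius_geI_ex')
    fix r :: real assume r: "0 < r" "ereal r < 1"
    \<comment> \<open>A radius strictly between \<open>r\<close> and 1 gives a geometric majorant
      with ratio \<open>r / s\<close>.\<close>
    define s where "s = (r + 1) / 2"
    have s: "0 < s" "s < 1" "r < s" using r by (auto simp: s_def one_ereal_def)
    obtain C where C: "\<And>n. norm (fps_nth F n) \<le> C / s ^ n"
      using bd[OF s(1,2)] by (auto simp: F_def)
    show "summable (\<lambda>n. fps_nth F n * of_real r ^ n)"
    proof (rule summable_comparison_test'[where N = 0])
      show "summable (\<lambda>n. C * (r / s) ^ n)"
        using r s by (intro summable_mult summable_geometric) auto
      show "norm (fps_nth F n * of_real r ^ n) \<le> C * (r / s) ^ n" for n
        using mult_right_mono[OF C[of n], of "r ^ n"] r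
        by (simp add: norm_mult norm_power power_divide)
    qed
  qed
  have sub: "ball (0::complex) 1 \<subseteq> eball 0 (fps_conv_radius F)"
  proof (intro subsetI)
    fix z :: complex assume "z \<in> ball 0 1"
    then have "ereal (norm z) < 1" by (simp add: one_ereal_def)
    then show "z \<in> eball 0 (fps_conv_radius F)" using less_le_trans[OF _ R] by (simp add: in_eball_iff)
  qed
  show hol: "eval_fps F holomorphic_on ball 0 1"
    by (rule holomorphic_on_eval_fps[OF sub])
  have hol': "(\<lambda>z. a * eval_fps F z - b * (m z * eval_fps F (\<beta> * z)) - g z)
      holomorphic_on ball 0 1"
    by (intro holomorphic_intros hol m g holomorphic_on_rotate[OF hol] \<open>norm \<beta> = 1\<close>)
  have "eval_fps F has_fps_expansion F"
    using less_le_trans[OF _ R, of 0] by (intro eval_fps_has_fps_expansion) simp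
  then have "(\<lambda>z. a * eval_fps F z - b * (m z * eval_fps F (\<beta> * z))) has_fps_expansion
    Abs_fps (\<lambda>n. a * fps_nth F n - b * (\<Sum>i\<le>n. \<beta> ^ i * fps_nth (fps_expansion m 0) (n - i)
       * fps_nth F i))"
    by (intro has_fps_expansion_transfer_op has_fps_expansion_disc m)
  also have "Abs_fps (\<lambda>n. a * fps_nth F n - b * (\<Sum>i\<le>n. \<beta> ^ i * fps_nth (fps_expansion m 0) (n - i)
       * fps_nth F i)) = fps_expansion g 0"
    unfolding F_def fps_eq_iff fps_nth_Abs_fps
    by (intro allI sol_coeff_eq) (use nz in \<open>simp add: fps_expansion_def\<close>)
  finally have "(\<lambda>z. a * eval_fps F z - b * (m z * eval_fps F (\<beta> * z)) - g z) has_fps_expansion 0"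
    using has_fps_expansion_diff[OF _ has_fps_expansion_disc[OF g]] by fastforce
  then show "a * eval_fps F z - b * (m z * eval_fps F (\<beta> * z)) = g z" if "z \<in> ball 0 1" for z
    using has_fps_expansion_0_analytic_continuation[OF _ hol' open_ball connected_ball _ that] by simp
qed

lemma solution_coeff_bound:
  assumes f: "f holomorphic_on ball 0 1" and "0 < r" "r < 1"
    and C: "\<And>z. norm z \<le> r \<Longrightarrow> norm (f z) \<le> C"
  shows "norm (fps_nth (fps_expansion f 0) n) \<le> C / r ^ n"
proof -
  have sub: "cball (0::complex) r \<subseteq> ball 0 1" using assms by auto
  have "norm ((deriv ^^ n) f 0) \<le> fact n * C / r ^ n"
    using sub assms
    by (intro Cauchy_inequality holomorphic_on_subset[OF f]
        continuous_on_subset[OF holomorphic_on_imp_continuous_on[OF f]]) auto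
  then show ?thesis
    by (simp add: fps_expansion_def norm_divide field_simps)
qed

text \<open>A geometric series with ratio \<open>r / s\<close> turns coefficient bounds back into a
  bound on values. It reverses the Cauchy estimate at the price of shrinking the radius from
  \<open>s\<close> to \<open>r\<close>.\<close>

lemma norm_eval_fps_le:
  fixes F :: "complex fps"
  assumes R: "fps_conv_radius F \<ge> 1" and rs: "0 < r" "r < s" "s < 1"
    and C: "\<And>n. norm (fps_nth F n) \<le> C / s ^ n" and z: "norm z \<le> r"
  shows "norm (eval_fps F z) \<le> C / (1 - r / s)"
proof -
  have "0 \<le> C" using C[of 0] norm_ge_zero[of "fps_nth F 0"] by (simp del: norm_ge_zero)
  have sm: "(\<lambda>n. C * (r / s) ^ n) sums (C * (1 / (1 - r / s)))"
    using rs by (intro sums_mult geometric_sums) auto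
  have le: "norm (fps_nth F n * z ^ n) \<le> C * (r / s) ^ n" for n
  proof -
    have "norm (fps_nth F n * z ^ n) \<le> C / s ^ n * r ^ n"
      unfolding norm_mult norm_power using rs z \<open>0 \<le> C\<close>
      by (intro mult_mono C power_mono) auto
    then show ?thesis by (simp add: power_divide)
  qed
  show ?thesis
    unfolding eval_fps_def using norm_suminf_le[OF le sums_summable[OF sm]] sums_unique[OF sm] by simp
qed

text \<open>The Taylor coefficients of the solution are rational functions of the parameter, so bounds
  on the boundary circle propagate to the disc by the maximum principle.\<close>

lemma unif_solvable_disc:
  assumes m: "m holomorphic_on ball 0 1" and "norm \<beta> = 1" and s: "0 < s"
    and ab: "a holomorphic_on UNIV" "b holomorphic_on UNIV"
    and nz: "\<And>w n. norm w \<le> s \<Longrightarrow> a w - b w * m 0 * \<beta> ^ n \<noteq> 0"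
    and U: "unif_solvable m \<beta> ((\<lambda>w. (a w, b w)) ` sphere 0 s)"
  shows "unif_solvable m \<beta> ((\<lambda>w. (a w, b w)) ` cball 0 s)"
proof (rule unif_solvableI)
  fix g :: "complex \<Rightarrow> complex" and r :: real
  assume g: "g holomorphic_on ball 0 1" and r: "0 < r" "r < 1"
  define c where "c = (\<lambda>w. sol_coeff \<beta> (fps_nth (fps_expansion m 0))
      (fps_nth (fps_expansion g 0)) (a w) (b w))"
  have M0: "fps_nth (fps_expansion m 0) 0 = m 0" by (simp add: fps_expansion_def)
  \<comment> \<open>By the recursion each coefficient is built from \<open>a\<close>,
    \<open>b\<close> and earlier coefficients by division by diagonal entries, which are nonzero on
    the closed disc.\<close>
  have hol: "(\<lambda>w. c w n) holomorphic_on cball 0 s" for n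
    unfolding c_def
  proof (induction n rule: less_induct)
    case (less n)
    then show ?case
      by (subst sol_coeff.simps)
         (intro holomorphic_intros less holomorphic_on_subset[OF ab(1)]
            holomorphic_on_subset[OF ab(2)], use nz in \<open>auto simp: M0\<close>)
  qed
  \<comment> \<open>The radius is quantified afresh, because convergence on the unit disc requires
    the estimate for every radius below 1.\<close>
  have bd: "\<exists>C. \<forall>w n. norm w \<le> s \<longrightarrow> norm (c w n) \<le> C / r ^ n" if r: "0 < r" "r < 1" for r
  proof -
    obtain C where C: "\<And>a' b'. (a', b') \<in> (\<lambda>w. (a w, b w)) ` sphere 0 s \<Longrightarrow>
        \<exists>f. f holomorphic_on ball 0 1 \<and>
          (\<forall>z\<in>ball 0 1. a' * f z - b' * (m z * f (\<beta> * z)) = g z) \<and>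
          (\<forall>z. norm z \<le> r \<longrightarrow> norm (f z) \<le> C)"
      using unif_solvableD[OF U g r] by blast
    \<comment> \<open>On the circle a bounded solution is given; by uniqueness its Taylor
      coefficients are the \<open>c w n\<close>, so Cauchy's estimate applies.\<close>
    have circ: "norm (c w n) \<le> C / r ^ n" if "norm w = s" for w n
    proof -
      have "(a w, b w) \<in> (\<lambda>w. (a w, b w)) ` sphere 0 s" using that by auto
      then obtain f where f: "f holomorphic_on ball 0 1"
          "\<And>z. z \<in> ball 0 1 \<Longrightarrow> a w * f z - b w * (m z * f (\<beta> * z)) = g z"
          "\<And>z. norm z \<le> r \<Longrightarrow> norm (f z) \<le> C"
        using C by blast
      have "c w n = fps_nth (fps_expansion f 0) n"
        unfolding c_def using nz[of w] that
        by (intro fps_nth_expansion_solution[symmetric] f g m) auto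
      then show ?thesis using solution_coeff_bound[OF f(1) r f(3)] by (simp only:)
    qed
    have "norm (c w n) \<le> C / r ^ n" if "norm w \<le> s" for w n
    proof (rule maximum_modulus_frontier[of "\<lambda>w. c w n" "cball 0 s"])
      show "(\<lambda>w. c w n) holomorphic_on interior (cball 0 s)"
        by (rule holomorphic_on_subset[OF hol interior_subset])
      show "continuous_on (closure (cball 0 s)) (\<lambda>w. c w n)"
        using holomorphic_on_imp_continuous_on[OF hol] by simp
      show "norm (c w n) \<le> C / r ^ n" if "w \<in> frontier (cball 0 s)" for w
        using that s by (intro circ) simp
    qed (use that in auto)
    then show ?thesis by blast
  qed
  \<comment> \<open>The coefficients are estimated at a radius \<open>t > r\<close>, which absorbs
    the loss in summing the series.\<close>
  define t where "t = (1 + r) / 2"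
  have t: "r < t" "0 < t" "t < 1" using r by (auto simp: t_def)
  obtain C where C: "\<And>w n. norm w \<le> s \<Longrightarrow> norm (c w n) \<le> C / t ^ n"
    using bd[OF t(2,3)] by blast
  have "\<exists>f. f holomorphic_on ball 0 1 \<and>
      (\<forall>z\<in>ball 0 1. a w * f z - b w * (m z * f (\<beta> * z)) = g z) \<and>
      (\<forall>z. norm z \<le> r \<longrightarrow> norm (f z) \<le> C / (1 - r / t))" if w: "norm w \<le> s" for w
  proof -
    have b: "\<exists>C. \<forall>n. norm (c w n) \<le> C / r ^ n" if "0 < r" "r < 1" for r
      using bd[OF that] w by blast
    note sol = solution_of_coeff_bounds[OF m g \<open>norm \<beta> = 1\<close> nz[OF w] b[unfolded c_def],
        folded c_def]
    show ?thesis
      using sol(2,3) norm_eval_fps_le[OF sol(1) r(1) t(1,3), of C] C[OF w]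
      by (intro exI[of _ "eval_fps (Abs_fps (c w))"]) (auto simp: c_def)
  qed
  then show "\<exists>C. \<forall>a' b'. (a', b') \<in> (\<lambda>w. (a w, b w)) ` cball 0 s \<longrightarrow>
      (\<exists>f. f holomorphic_on ball 0 1 \<and>
        (\<forall>z\<in>ball 0 1. a' * f z - b' * (m z * f (\<beta> * z)) = g z) \<and>
        (\<forall>z. norm z \<le> r \<longrightarrow> norm (f z) \<le> C))"
    by (intro exI[of _ "C / (1 - r / t)"]) auto
qed

section \<open>Rotation invariance\<close>

text \<open>\<open>h\<close> is the difference quotient at 0, with its removable singularity filled
  by the derivative.\<close>

lemma holomorphic_disc_factor_X:
  assumes "f holomorphic_on ball 0 1"
  obtains h :: "complex \<Rightarrow> complex"
  where "h holomorphic_on ball 0 1" "\<And>z. f z = f 0 + z * h z"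
proof
  show "(\<lambda>z. if z = 0 then deriv f 0 else (f z - f 0) / (z - 0)) holomorphic_on ball 0 1"
    by (rule pole_lemma_open[OF assms open_ball])
qed auto

text \<open>Multiplication by the coordinate intertwines \<open>\<mu> - T\<close> with
  \<open>\<beta>\<mu> - T\<close> up to the factor \<open>\<beta>\<close>, and the constants
  contribute only the eigenvalue \<open>m 0\<close>.\<close>

lemma unif_solvable_rotate:
  assumes m: "m holomorphic_on ball 0 1" and \<beta>: "norm \<beta> = 1" and d: "0 < d"
    and K: "\<And>\<mu>. \<mu> \<in> K \<Longrightarrow> d \<le> norm (\<beta> * \<mu> - m 0)"
    and U: "unif_solvable m \<beta> ((\<lambda>\<mu>. (\<mu>, 1)) ` K)"
  shows "unif_solvable m \<beta> ((\<lambda>\<mu>. (\<beta> * \<mu>, 1)) ` K)"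
proof (rule unif_solvableI)
  fix g :: "complex \<Rightarrow> complex" and r :: real
  assume g: "g holomorphic_on ball 0 1" and r: "0 < r" "r < 1"
  have \<beta>0: "\<beta> \<noteq> 0" using \<beta> by auto
  obtain g1 where g1: "g1 holomorphic_on ball 0 1" "\<And>z. g z = g 0 + z * g1 z"
    using holomorphic_disc_factor_X[OF g] by blast
  obtain m1 where m1: "m1 holomorphic_on ball 0 1" "\<And>z. m z = m 0 + z * m1 z"
    using holomorphic_disc_factor_X[OF m] by blast
  have "(\<lambda>z. g1 z / \<beta>) holomorphic_on ball 0 1" "(\<lambda>z. m1 z / \<beta>) holomorphic_on ball 0 1"
    using \<beta>0 by (auto intro!: holomorphic_intros g1 m1)
  note hol = this
  obtain C1 where C1: "\<And>a b. (a, b) \<in> (\<lambda>\<mu>. (\<mu>, 1)) ` K \<Longrightarrow> \<exists>f. f holomorphic_on ball 0 1 \<and>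
      (\<forall>z\<in>ball 0 1. a * f z - b * (m z * f (\<beta> * z)) = g1 z / \<beta>) \<and>
      (\<forall>z. norm z \<le> r \<longrightarrow> norm (f z) \<le> C1)"
    using unif_solvableD[OF U hol(1) r] by blast
  obtain C2 where C2: "\<And>a b. (a, b) \<in> (\<lambda>\<mu>. (\<mu>, 1)) ` K \<Longrightarrow> \<exists>f. f holomorphic_on ball 0 1 \<and>
      (\<forall>z\<in>ball 0 1. a * f z - b * (m z * f (\<beta> * z)) = m1 z / \<beta>) \<and>
      (\<forall>z. norm z \<le> r \<longrightarrow> norm (f z) \<le> C2)"
    using unif_solvableD[OF U hol(2) r] by blast
  have "\<exists>f. f holomorphic_on ball 0 1 \<and>
      (\<forall>z\<in>ball 0 1. \<beta> * \<mu> * f z - 1 * (m z * f (\<beta> * z)) = g z) \<and>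
      (\<forall>z. norm z \<le> r \<longrightarrow> norm (f z) \<le> norm (g 0) / d + (C1 + norm (g 0) / d * C2))"
    if \<mu>: "\<mu> \<in> K" for \<mu>
  proof -
    obtain f1 where f1: "f1 holomorphic_on ball 0 1"
      "\<And>z. z\<in>ball 0 1 \<Longrightarrow> \<mu> * f1 z - 1 * (m z * f1 (\<beta> * z)) = g1 z / \<beta>"
      "\<And>z. norm z \<le> r \<Longrightarrow> norm (f1 z) \<le> C1" using C1[OF imageI[OF \<mu>]] by blast
    obtain f2 where f2: "f2 holomorphic_on ball 0 1"
      "\<And>z. z\<in>ball 0 1 \<Longrightarrow> \<mu> * f2 z - 1 * (m z * f2 (\<beta> * z)) = m1 z / \<beta>"
      "\<And>z. norm z \<le> r \<Longrightarrow> norm (f2 z) \<le> C2" using C2[OF imageI[OF \<mu>]] by blast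
    \<comment> \<open>Ansatz \<open>f = c + z * h\<close>. Comparison at \<open>z = 0\<close> forces
      this \<open>c\<close>, which \<open>d\<close> bounds uniformly; dividing the rest by
      \<open>z\<close> leaves \<open>(\<mu> - T) h = (g1 + c * m1) / \<beta>\<close>, solved by
      \<open>h = f1 + c * f2\<close>.\<close>
    define c where "c = g 0 / (\<beta> * \<mu> - m 0)"
    define f where "f = (\<lambda>z. c + z * (f1 z + c * f2 z))"
    have nz: "\<beta> * \<mu> - m 0 \<noteq> 0" using K[OF \<mu>] d by auto
    have c: "norm c \<le> norm (g 0) / d"
      unfolding c_def norm_divide using K[OF \<mu>] d nz by (intro divide_left_mono mult_pos_pos) auto
    have f: "f holomorphic_on ball 0 1"
      unfolding f_def by (intro holomorphic_intros f1 f2)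
    have eq: "\<beta> * \<mu> * f z - 1 * (m z * f (\<beta> * z)) = g z" if z: "z \<in> ball 0 1" for z
    proof -
      have "\<beta> * \<mu> * f z - 1 * (m z * f (\<beta> * z)) = c * (\<beta> * \<mu> - m z)
        + z * \<beta> * ((\<mu> * f1 z - 1 * (m z * f1 (\<beta> * z))) + c * (\<mu> * f2 z - 1 * (m z * f2 (\<beta> * z))))"
        by (simp add: f_def algebra_simps)
      also have "\<dots> = c * (\<beta> * \<mu> - m z) + z * (g1 z + c * m1 z)"
        unfolding f1(2)[OF z] f2(2)[OF z] using \<beta>0 by (simp add: field_simps)
      also have "\<dots> = c * (\<beta> * \<mu> - m 0) + z * g1 z"
        by (subst m1(2)) (simp add: algebra_simps)
      also have "\<dots> = g z"
        using nz g1(2)[of z] by (simp add: c_def)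
      finally show ?thesis .
    qed
    have "norm (f z) \<le> norm (g 0) / d + (C1 + norm (g 0) / d * C2)" if z: "norm z \<le> r" for z
    proof -
      have "norm (z * (f1 z + c * f2 z)) \<le> 1 * (C1 + norm (g 0) / d * C2)"
        unfolding norm_mult
      proof (intro mult_mono)
        have "norm (c * f2 z) \<le> norm (g 0) / d * C2"
          unfolding norm_mult using c f2(3)[OF z] d by (intro mult_mono) auto
        then show "norm (f1 z + c * f2 z) \<le> C1 + norm (g 0) / d * C2"
          using f1(3)[OF z] by (intro norm_triangle_le) auto
      qed (use z r in auto)
      then show ?thesis unfolding f_def using c by (intro norm_triangle_le) auto
    qed
    with f eq show ?thesis by blast
  qed
  then show "\<exists>C. \<forall>a b. (a, b) \<in> (\<lambda>\<mu>. (\<beta> * \<mu>, 1)) ` K \<longrightarrow>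
      (\<exists>f. f holomorphic_on ball 0 1 \<and>
        (\<forall>z\<in>ball 0 1. a * f z - b * (m z * f (\<beta> * z)) = g z) \<and>
        (\<forall>z. norm z \<le> r \<longrightarrow> norm (f z) \<le> C))"
    by (intro exI[of _ "norm (g 0) / d + (C1 + norm (g 0) / d * C2)"]) auto
qed

text \<open>Kronecker's theorem: the rotation angle is irrational because no power of
  \<open>\<beta>\<close> is 1, so the fractional parts of its multiples are dense in
  \<open>[0, 1]\<close>, and the continuous map onto the circle carries density over.\<close>

lemma dense_powers_on_circle:
  fixes \<beta> x :: complex
  assumes \<beta>: "norm \<beta> = 1" and aper: "\<And>n::nat. n \<ge> 1 \<Longrightarrow> \<beta> ^ n \<noteq> 1"
    and x: "norm x = 1" and \<delta>: "0 < \<delta>"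
  obtains n :: nat where "norm (\<beta> ^ n - x) < \<delta>"
proof -
  let ?e = "\<lambda>t. cis (2 * pi * t)"
  obtain u where u: "\<beta> = cis u" using \<beta> by (metis cis_Arg norm_zero sgn_eq zero_neq_one div_by_1 of_real_1)
  define \<theta> where "\<theta> = u / (2 * pi)"
  have \<beta>\<theta>: "\<beta> = ?e \<theta>" by (simp add: u \<theta>_def)
  have int: "?e (of_int k) = 1" for k
    using cis_multiple_2pi[of "of_int k"] by (simp add: mult.commute)
  have frac: "?e (frac t) = ?e t" for t
    using int[of "\<lfloor>t\<rfloor>"] by (simp add: frac_def right_diff_distrib flip: cis_divide)
  have pow: "\<beta> ^ n = ?e (frac (real n * \<theta>))" for n
  proof -
    have "\<beta> ^ n = cis (real n * (2 * pi * \<theta>))" by (simp only: \<beta>\<theta> Complex.DeMoivre)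
    also have "real n * (2 * pi * \<theta>) = 2 * pi * (real n * \<theta>)" by (simp only: mult_ac)
    finally show ?thesis by (simp only: frac)
  qed
  have "\<theta> \<notin> \<rat>"
  proof
    assume "\<theta> \<in> \<rat>"
    then obtain p q :: int where pq: "q > 0" "\<theta> = of_int p / of_int q" by (meson Rats_cases')
    then have "real (nat q) * \<theta> = of_int p" by simp
    then have "\<beta> ^ nat q = 1" by (simp add: pow frac int del: of_nat_nat)
    then show False using aper[of "nat q"] pq(1) by simp
  qed
  then have cl: "closure (range (\<lambda>n. frac (real n * \<theta>))) = {0..1}"
    by (rule Kronecker_approx_1)
  obtain v where v: "x = cis v" using x by (metis cis_Arg norm_zero sgn_eq zero_neq_one div_by_1 of_real_1)
  define t where "t = frac (v / (2 * pi))"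
  have xt: "x = ?e t" unfolding t_def frac by (simp add: v)
  have "t \<in> closure (range (\<lambda>n. frac (real n * \<theta>)))"
    unfolding cl t_def by (simp add: frac_ge_0 less_imp_le[OF frac_lt_1])
  moreover have "?e ` closure (range (\<lambda>n. frac (real n * \<theta>)))
      \<subseteq> closure (?e ` range (\<lambda>n. frac (real n * \<theta>)))"
    by (intro image_closure_subset closure_subset closed_closure continuous_intros) 
  ultimately have "x \<in> closure (range (\<lambda>n. \<beta> ^ n))"
    unfolding xt by (auto simp: image_image pow)
  then obtain n where "dist (\<beta> ^ n) x < \<delta>"
    using \<delta> unfolding closure_approachable by blast
  then show ?thesis using that by (simp add: dist_norm)
qed

text \<open>Rotating a small disc about \<open>l\<close> by powers of \<open>\<beta>\<close>
  preserves uniform solvability. By density the rotated discs cover the circle, and by compactness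
  finitely many suffice.\<close>

lemma unif_solvable_circle:
  assumes m: "m holomorphic_on ball 0 1" and \<beta>: "norm \<beta> = 1"
    and aper: "\<And>n::nat. n \<ge> 1 \<Longrightarrow> \<beta> ^ n \<noteq> 1"
    and l: "l \<noteq> 0" "norm l \<noteq> norm (m 0)" and \<delta>: "0 < \<delta>"
    and U: "unif_solvable m \<beta> ((\<lambda>\<mu>. (\<mu>, 1)) ` cball l \<delta>)"
  shows "unif_solvable m \<beta> ((\<lambda>\<mu>. (\<mu>, 1)) ` sphere 0 (norm l))"
proof -
  \<comment> \<open>Half the gap to the critical circle: discs of radius at most \<open>d\<close>
    keep all their rotates at distance at least \<open>d\<close> from \<open>m 0\<close>, as each
    rotation step requires.\<close>
  define d where "d = \<bar>norm l - norm (m 0)\<bar> / 2"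
  have d: "0 < d" using l by (simp add: d_def)
  define \<epsilon> where "\<epsilon> = min \<delta> d"
  have \<epsilon>: "0 < \<epsilon>" using \<delta> d by (simp add: \<epsilon>_def)
  have n\<beta>: "norm (\<beta> ^ k) = 1" for k by (simp add: norm_power \<beta>)
  have rot: "unif_solvable m \<beta> ((\<lambda>\<mu>. (\<beta> ^ k * \<mu>, 1)) ` cball l \<epsilon>)" for k
  proof (induction k)
    case 0
    then show ?case
      using \<delta> by (auto intro!: unif_solvable_mono[OF U] simp: \<epsilon>_def)
  next
    case (Suc k)
    have "d \<le> norm (\<beta> * \<mu>' - m 0)" if "\<mu>' \<in> (\<lambda>\<mu>. \<beta> ^ k * \<mu>) ` cball l \<epsilon>" for \<mu>'
    proof -
      obtain \<mu> where \<mu>: "\<mu>' = \<beta> ^ k * \<mu>" "\<mu> \<in> cball l \<epsilon>" using \<open>\<mu>' \<in> _\<close> by blast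
      have "\<bar>norm l - norm \<mu>\<bar> \<le> d"
        using norm_triangle_ineq3[of l \<mu>] \<mu>(2) d by (simp add: \<epsilon>_def dist_norm)
      moreover have "\<bar>norm (\<beta> * \<mu>') - norm (m 0)\<bar> \<le> norm (\<beta> * \<mu>' - m 0)"
        by (rule norm_triangle_ineq3)
      moreover have "norm (\<beta> * \<mu>') = norm \<mu>" by (simp add: \<mu>(1) norm_mult \<beta> n\<beta>)
      moreover have "\<bar>A - B\<bar> / 2 \<le> E" if "\<bar>A - C\<bar> \<le> \<bar>A - B\<bar> / 2" "\<bar>C - B\<bar> \<le> E"
        for A B C E :: real using that by (simp add: abs_if split: if_splits)
      ultimately show ?thesis unfolding d_def by metis
    qed
    moreover have "unif_solvable m \<beta> ((\<lambda>\<mu>. (\<mu>, 1)) ` (\<lambda>\<mu>. \<beta> ^ k * \<mu>) ` cball l \<epsilon>)"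
      using Suc by (simp add: image_image)
    ultimately have "unif_solvable m \<beta> ((\<lambda>\<mu>. (\<beta> * \<mu>, 1)) ` (\<lambda>\<mu>. \<beta> ^ k * \<mu>) ` cball l \<epsilon>)"
      by (intro unif_solvable_rotate[OF m \<beta> d]) auto
    then show ?case by (simp add: image_image mult.assoc)
  qed
  have "sphere 0 (norm l) \<subseteq> (\<Union>k\<in>(UNIV :: nat set). ball (\<beta> ^ k * l) \<epsilon>)"
  proof
    fix \<mu> :: complex assume \<mu>: "\<mu> \<in> sphere 0 (norm l)"
    then have "norm (\<mu> / l) = 1" using l by (simp add: norm_divide)
    then obtain k where "norm (\<beta> ^ k - \<mu> / l) < \<epsilon> / norm l"
      using dense_powers_on_circle[OF \<beta> aper, of "\<mu> / l" "\<epsilon> / norm l"] \<epsilon> l by auto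
    then have "norm ((\<beta> ^ k - \<mu> / l) * l) < \<epsilon>"
      using l by (simp add: norm_mult pos_less_divide_eq)
    then have "dist (\<beta> ^ k * l) \<mu> < \<epsilon>"
      using l by (simp add: dist_norm algebra_simps)
    then show "\<mu> \<in> (\<Union>k\<in>UNIV. ball (\<beta> ^ k * l) \<epsilon>)" by auto
  qed
  then obtain I where I: "finite I" "sphere 0 (norm l) \<subseteq> (\<Union>k\<in>I. ball (\<beta> ^ k * l) \<epsilon>)"
    by (rule compactE_image[OF compact_sphere, rotated]) auto
  have "unif_solvable m \<beta> (\<Union>k\<in>I. (\<lambda>\<mu>. (\<beta> ^ k * \<mu>, 1)) ` cball l \<epsilon>)"
    by (rule unif_solvable_UN[OF I(1) rot])
  then show ?thesis
  proof (rule unif_solvable_mono, safe)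
    fix \<mu> :: complex assume "\<mu> \<in> sphere 0 (norm l)"
    then obtain k where k: "k \<in> I" "dist (\<beta> ^ k * l) \<mu> < \<epsilon>" using I(2) by fastforce
    have \<beta>0: "\<beta> ^ k \<noteq> 0" using \<beta> by auto
    have "\<beta> ^ k * l - \<mu> = \<beta> ^ k * (l - \<mu> / \<beta> ^ k)"
      using \<beta>0 by (simp add: right_diff_distrib)
    then have "dist l (\<mu> / \<beta> ^ k) < \<epsilon>"
      using k(2) unfolding dist_norm by (simp only: norm_mult n\<beta> mult_1)
    then have "\<mu> / \<beta> ^ k \<in> cball l \<epsilon>" by simp
    moreover have "(\<mu>, 1) = (\<beta> ^ k * (\<mu> / \<beta> ^ k), 1::complex)" using \<beta>0 by simp
    ultimately show "(\<mu>, 1) \<in> (\<Union>k\<in>I. (\<lambda>\<mu>. (\<beta> ^ k * \<mu>, 1)) ` cball l \<epsilon>)"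
      using k(1) by blast
  qed
qed

section \<open>Zero-free weights\<close>

text \<open>Up to an error \<open>\<epsilon>\<close> per term, \<open>h\<close> is a Taylor
  polynomial on the smaller disc. A monomial of positive degree contributes a geometric sum bounded
  independently of \<open>n\<close>, and the constant term is \<open>h 0 = 0\<close>.\<close>

lemma birkhoff_sum_bound:
  assumes h: "h holomorphic_on ball 0 1" "h 0 = 0" and \<beta>: "norm \<beta> = 1"
    and aper: "\<And>n::nat. n \<ge> 1 \<Longrightarrow> \<beta> ^ n \<noteq> 1" and r: "0 < r" "r < 1" and \<epsilon>: "0 < \<epsilon>"
  obtains B where "\<And>n z. norm z \<le> r \<Longrightarrow> norm (\<Sum>k<n. h (\<beta> ^ k * z)) \<le> B + \<epsilon> * real n"
proof -
  define a where "a = fps_nth (fps_expansion h 0)"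
  have hol: "h holomorphic_on eball 0 1" using h(1) by (simp add: one_ereal_def)
  have "fps_conv_radius (fps_expansion h 0) \<ge> 1"
    by (rule conv_radius_fps_expansion[OF hol])
  then have "ereal r < conv_radius a"
    using less_le_trans[of "ereal r" 1] r by (simp add: a_def fps_conv_radius_def one_ereal_def)
  then have "uniform_limit (cball 0 r) (\<lambda>n x. \<Sum>i<n. a i * (x - 0) ^ i)
      (\<lambda>x. suminf (\<lambda>i. a i * (x - 0) ^ i)) sequentially"
    by (rule powser_uniform_limit)
  then have "\<forall>\<^sub>F n in sequentially. \<forall>x\<in>cball 0 r.
      dist (\<Sum>i<n. a i * (x - 0) ^ i) (suminf (\<lambda>i. a i * (x - 0) ^ i)) < \<epsilon>"
    using \<epsilon> by (rule uniform_limitD)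
  then obtain N where N: "\<And>x. norm x \<le> r \<Longrightarrow>
      dist (\<Sum>i<N. a i * x ^ i) (suminf (\<lambda>i. a i * x ^ i)) < \<epsilon>"
    unfolding eventually_sequentially by fastforce
  have pN: "norm (h x - (\<Sum>i<N. a i * x ^ i)) < \<epsilon>" if "norm x \<le> r" for x
  proof -
    have "suminf (\<lambda>i. a i * x ^ i) = h x"
      using eval_fps_expansion'[OF hol, of x] that r
      by (simp add: eval_fps_def a_def one_ereal_def)
    then show ?thesis using N[OF that] by (simp add: dist_norm norm_minus_commute)
  qed
  \<comment> \<open>Each geometric sum is at most \<open>2 / norm (\<beta> ^ i - 1)\<close>. For
    \<open>i = 0\<close> this is a division by zero with value 0, which is correct because
    \<open>a 0 = 0\<close>.\<close>
  define B where "B = (\<Sum>i<N. norm (a i) * (2 / norm (\<beta> ^ i - 1)))"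
  have a0: "a 0 = 0" by (simp add: a_def fps_expansion_def h(2))
  have n\<beta>: "norm (\<beta> ^ k) = 1" for k by (simp add: norm_power \<beta>)
  have "norm (\<Sum>k<n. h (\<beta> ^ k * z)) \<le> B + \<epsilon> * real n" if z: "norm z \<le> r" for n z
  proof -
    have nz: "norm (\<beta> ^ k * z) \<le> r" for k using z by (simp add: norm_mult n\<beta>)
    have "norm (\<Sum>k<n. h (\<beta> ^ k * z) - (\<Sum>i<N. a i * (\<beta> ^ k * z) ^ i)) \<le> (\<Sum>k<n. \<epsilon>)"
      by (intro sum_norm_le less_imp_le pN nz)
    moreover have "norm (\<Sum>k<n. \<Sum>i<N. a i * (\<beta> ^ k * z) ^ i) \<le> B"
    proof -
      have "(\<Sum>k<n. \<Sum>i<N. a i * (\<beta> ^ k * z) ^ i) = (\<Sum>i<N. \<Sum>k<n. a i * (\<beta> ^ k * z) ^ i)"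
        by (rule sum.swap)
      also have "\<dots> = (\<Sum>i<N. a i * z ^ i * (\<Sum>k<n. (\<beta> ^ i) ^ k))"
        by (simp add: sum_distrib_left power_mult_distrib mult_ac flip: power_mult)
      also have "norm \<dots> \<le> B"
        unfolding B_def
      proof (rule sum_norm_le)
        fix i
        show "norm (a i * z ^ i * (\<Sum>k<n. (\<beta> ^ i) ^ k)) \<le> norm (a i) * (2 / norm (\<beta> ^ i - 1))"
        proof (cases "i = 0")
          case False
          then have ne: "\<beta> ^ i \<noteq> 1" using aper[of i] by simp
          have "norm ((\<beta> ^ i) ^ n - 1) \<le> 2"
            using norm_triangle_ineq4[of "(\<beta> ^ i) ^ n" 1] n\<beta>[of "i * n"] by (simp add: power_mult)
          then have "norm (\<Sum>k<n. (\<beta> ^ i) ^ k) \<le> 2 / norm (\<beta> ^ i - 1)"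
            by (simp add: geometric_sum[OF ne] norm_divide divide_right_mono)
          moreover have "norm (a i * z ^ i) \<le> norm (a i) * 1"
            unfolding norm_mult norm_power using z r by (intro mult_mono power_le_one) auto
          ultimately show ?thesis
            unfolding norm_mult[of "a i * z ^ i"] by (intro mult_mono) auto
        qed (simp add: a0)
      qed
      finally show ?thesis .
    qed
    moreover have "(\<Sum>k<n. h (\<beta> ^ k * z)) = (\<Sum>k<n. h (\<beta> ^ k * z) - (\<Sum>i<N. a i * (\<beta> ^ k * z) ^ i))
        + (\<Sum>k<n. \<Sum>i<N. a i * (\<beta> ^ k * z) ^ i)"
      by (simp add: sum_subtractf)
    ultimately show ?thesis
      using norm_triangle_ineq[of "\<Sum>k<n. h (\<beta> ^ k * z) - (\<Sum>i<N. a i * (\<beta> ^ k * z) ^ i)"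
          "\<Sum>k<n. \<Sum>i<N. a i * (\<beta> ^ k * z) ^ i"] by (simp add: mult.commute)
  qed
  then show ?thesis using that by blast
qed

text \<open>A zero-free weight on the disc has the form \<open>m 0 * exp h\<close> with
  \<open>h 0 = 0\<close>, so its products along an orbit are \<open>m 0 ^ n\<close> times the
  exponential of a Birkhoff sum.\<close>

lemma cocycle_growth:
  assumes m: "m holomorphic_on ball 0 1" "\<And>z. z \<in> ball 0 1 \<Longrightarrow> m z \<noteq> 0" and \<beta>: "norm \<beta> = 1"
    and aper: "\<And>n::nat. n \<ge> 1 \<Longrightarrow> \<beta> ^ n \<noteq> 1" and r: "0 < r" "r < 1" and \<epsilon>: "0 < \<epsilon>"
  obtains B where "\<And>n z. norm z \<le> r \<Longrightarrow>
    norm (\<Prod>k<n. m (\<beta> ^ k * z)) \<le> B * (norm (m 0) * exp \<epsilon>) ^ n"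
proof -
  obtain g where g: "g holomorphic_on ball 0 1" "\<And>z. z \<in> ball 0 1 \<Longrightarrow> exp (g z) = m z"
    using holomorphic_logarithm_exists[OF convex_ball open_ball m, of 0] by auto
  define h where "h = (\<lambda>z. g z - g 0)"
  have h: "h holomorphic_on ball 0 1" "h 0 = 0"
    unfolding h_def by (auto intro!: holomorphic_intros g)
  have mh: "m z = m 0 * exp (h z)" if "z \<in> ball 0 1" for z
    using g(2)[of 0] g(2)[OF that] m(2)[of 0] by (simp add: h_def exp_diff)
  obtain B where B: "\<And>n z. norm z \<le> r \<Longrightarrow> norm (\<Sum>k<n. h (\<beta> ^ k * z)) \<le> B + \<epsilon> * real n"
    using birkhoff_sum_bound[OF h \<beta> aper r \<epsilon>] by blast
  have "norm (\<Prod>k<n. m (\<beta> ^ k * z)) \<le> exp B * (norm (m 0) * exp \<epsilon>) ^ n"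
    if z: "norm z \<le> r" for n z
  proof -
    have "(\<Prod>k<n. m (\<beta> ^ k * z)) = (\<Prod>k<n. m 0 * exp (h (\<beta> ^ k * z)))"
      using z r by (intro prod.cong mh) (auto simp: norm_mult norm_power \<beta>)
    also have "\<dots> = m 0 ^ n * exp (\<Sum>k<n. h (\<beta> ^ k * z))"
      by (simp add: prod.distrib exp_sum)
    also have "norm \<dots> \<le> norm (m 0) ^ n * exp (B + \<epsilon> * real n)"
      unfolding norm_mult norm_power
      by (intro mult_left_mono order_trans[OF norm_exp] exp_le_cancel_iff[THEN iffD2] B z) simp
    also have "\<dots> = exp B * (norm (m 0) * exp \<epsilon>) ^ n"
      by (simp add: exp_add power_mult_distrib mult.commute[of \<epsilon>] exp_of_nat_mult)
    finally show ?thesis .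
  qed
  then show ?thesis using that by blast
qed

text \<open>The Neumann series for \<open>1 - \<nu> T\<close> converges locally uniformly, since the
  cocycle grows at rate arbitrarily close to \<open>norm (m 0)\<close>.\<close>

lemma unif_solvable_neumann:
  assumes m: "m holomorphic_on ball 0 1" "\<And>z. z \<in> ball 0 1 \<Longrightarrow> m z \<noteq> 0" and \<beta>: "norm \<beta> = 1"
    and aper: "\<And>n::nat. n \<ge> 1 \<Longrightarrow> \<beta> ^ n \<noteq> 1" and s: "0 \<le> s" "s * norm (m 0) < 1"
  shows "unif_solvable m \<beta> ((\<lambda>\<nu>. (1, \<nu>)) ` cball 0 s)"
proof (rule unif_solvableI)
  fix g :: "complex \<Rightarrow> complex" and r0 :: real
  assume g: "g holomorphic_on ball 0 1" and r0: "0 < r0" "r0 < 1"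
  have m0: "norm (m 0) > 0" using m(2)[of 0] by simp
  define q where "q = (s * norm (m 0) + 1) / 2"
  have q: "0 < q" "q < 1" "s * norm (m 0) < q" 
  proof -
    have "0 \<le> s * norm (m 0)" using s(1) by simp
    then show "0 < q" "q < 1" "s * norm (m 0) < q"
      using s(2) by (auto simp: q_def simp del: zero_le_mult_iff mult_nonneg_nonneg)
  qed
  \<comment> \<open>The loss \<open>exp \<epsilon>\<close> in the growth rate must fit into the gap
    between \<open>s * norm (m 0)\<close> and \<open>q\<close>; for \<open>s > 0\<close> the
    logarithm of their quotient is the largest admissible value.\<close>
  obtain \<epsilon> where \<epsilon>: "0 < \<epsilon>" "s * (norm (m 0) * exp \<epsilon>) \<le> q"
  proof (cases "s = 0")
    case True
    then show ?thesis using that[of 1] q by simp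
  next
    case False
    then have "s * norm (m 0) > 0" using s m0 by simp
    then show ?thesis using that[of "ln (q / (s * norm (m 0)))"] q s False m0
      by (simp add: divide_simps)
  qed
  have n\<beta>: "norm (\<beta> ^ k) = 1" for k by (simp add: norm_power \<beta>)
  \<comment> \<open>This is the \<open>n\<close>-th Neumann term \<open>(\<nu> T) ^ n g\<close>
    written out along the orbit of \<open>z\<close>.\<close>
  define t where "t = (\<lambda>\<nu> n z. \<nu> ^ n * (\<Prod>k<n. m (\<beta> ^ k * z)) * g (\<beta> ^ n * z))"
  define f where "f = (\<lambda>\<nu> z. \<Sum>n. t \<nu> n z)"
  have bd: "\<exists>D. \<forall>\<nu> n z. norm \<nu> \<le> s \<longrightarrow> norm z \<le> r \<longrightarrow> norm (t \<nu> n z) \<le> D * q ^ n"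
    if r: "0 < r" "r < 1" for r
  proof -
    obtain B where B: "\<And>n z. norm z \<le> r \<Longrightarrow>
        norm (\<Prod>k<n. m (\<beta> ^ k * z)) \<le> B * (norm (m 0) * exp \<epsilon>) ^ n"
      using cocycle_growth[OF m \<beta> aper r \<epsilon>(1)] by blast
    have B0: "0 \<le> B" using B[of 0 0] r by simp
    have "compact (g ` cball 0 r)"
      using r by (intro compact_continuous_image holomorphic_on_imp_continuous_on
          holomorphic_on_subset[OF g]) auto
    then obtain G where G: "\<And>z. norm z \<le> r \<Longrightarrow> norm (g z) \<le> G"
      by (meson bounded_iff compact_imp_bounded image_eqI mem_cball_0)
    have "norm (t \<nu> n z) \<le> B * G * q ^ n" if \<nu>: "norm \<nu> \<le> s" and z: "norm z \<le> r" for \<nu> n z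
    proof -
      have "norm (t \<nu> n z) \<le> s ^ n * (B * (norm (m 0) * exp \<epsilon>) ^ n) * G"
        unfolding t_def norm_mult norm_power[of \<nu>] using B0 s m0 z
        by (intro mult_mono power_mono \<nu> B z G) (auto simp: norm_mult n\<beta>)
      also have "\<dots> = B * G * (s * (norm (m 0) * exp \<epsilon>)) ^ n"
        by (simp add: power_mult_distrib)
      also have "\<dots> \<le> B * G * q ^ n"
        using \<epsilon> s m0 B0 order_trans[OF norm_ge_zero G[OF z]]
        by (intro mult_left_mono power_mono) auto
      finally show ?thesis .
    qed
    then show ?thesis by blast
  qed
  have smq: "summable (\<lambda>n. D * q ^ n)" for D :: real
    using q by (intro summable_mult summable_geometric) auto
  have hol_t: "t \<nu> n holomorphic_on ball 0 1" for \<nu> n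
    unfolding t_def
    by (intro holomorphic_intros holomorphic_on_rotate[OF g n\<beta>] holomorphic_on_rotate[OF m(1) n\<beta>])
  have summ: "summable (\<lambda>n. t \<nu> n z)" if "norm \<nu> \<le> s" "z \<in> ball 0 1" for \<nu> z
  proof -
    have "0 < (1 + norm z) / 2" "(1 + norm z) / 2 < 1" "norm z \<le> (1 + norm z) / 2"
      using that by (auto simp: add_pos_nonneg)
    with bd obtain D where "\<And>n. norm (t \<nu> n z) \<le> D * q ^ n" using \<open>norm \<nu> \<le> s\<close> by metis
    then show ?thesis by (intro summable_comparison_test'[OF smq[of D], where N = 0])
  qed
  have hol: "f \<nu> holomorphic_on ball 0 1" if \<nu>: "norm \<nu> \<le> s" for \<nu>
  proof (rule holomorphic_uniform_sequence[OF open_ball, where f = "\<lambda>N z. \<Sum>n<N. t \<nu> n z"])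
    show "(\<lambda>z. \<Sum>n<N. t \<nu> n z) holomorphic_on ball 0 1" for N
      by (intro holomorphic_intros hol_t)
    fix x :: complex assume x: "x \<in> ball 0 1"
    define r where "r = (1 + norm x) / 2"
    have r: "0 < r" "r < 1" "norm x < r" using x by (auto simp: r_def add_pos_nonneg)
    obtain D where D: "\<And>n z. norm z \<le> r \<Longrightarrow> norm (t \<nu> n z) \<le> D * q ^ n"
      using bd[OF r(1,2)] \<nu> by blast
    have sub: "cball x (r - norm x) \<subseteq> cball 0 r"
      by (rule cball_subset_cball_iff[THEN iffD2]) (simp add: dist_norm)
    have "uniform_limit (cball 0 r) (\<lambda>N z. \<Sum>n<N. t \<nu> n z) (f \<nu>) sequentially"
      unfolding f_def by (rule Weierstrass_m_test[OF _ smq[of D]]) (use D in auto)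
    then show "\<exists>d>0. cball x d \<subseteq> ball 0 1 \<and>
        uniform_limit (cball x d) (\<lambda>N z. \<Sum>n<N. t \<nu> n z) (f \<nu>) sequentially"
      using sub r by (intro exI[of _ "r - norm x"]) (force intro: uniform_limit_on_subset)
  qed
  obtain D where D: "\<And>\<nu> n z. norm \<nu> \<le> s \<Longrightarrow> norm z \<le> r0 \<Longrightarrow> norm (t \<nu> n z) \<le> D * q ^ n"
    using bd[OF r0] by blast
  have bound: "norm (f \<nu> z) \<le> (\<Sum>n. D * q ^ n)" if "norm \<nu> \<le> s" "norm z \<le> r0" for \<nu> z
    unfolding f_def by (rule norm_suminf_le[OF D[OF that] smq])
  have eq: "1 * f \<nu> z - \<nu> * (m z * f \<nu> (\<beta> * z)) = g z"
    if \<nu>: "norm \<nu> \<le> s" and z: "z \<in> ball 0 1" for \<nu> z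
  proof -
    have z': "\<beta> * z \<in> ball 0 1" using z by (simp add: norm_mult \<beta>)
    \<comment> \<open>Applying \<open>\<nu> T\<close> shifts the index, so splitting off the term
      \<open>n = 0\<close>, which is \<open>g\<close>, gives the equation.\<close>
    have t_Suc: "t \<nu> (Suc n) z = \<nu> * (m z * t \<nu> n (\<beta> * z))" for n
      unfolding t_def prod.lessThan_Suc_shift by (simp add: mult_ac)
    have "f \<nu> z = (\<Sum>n. t \<nu> (Suc n) z) + t \<nu> 0 z"
      unfolding f_def using suminf_split_head[OF summ[OF \<nu> z]] by simp
    also have "(\<Sum>n. t \<nu> (Suc n) z) = \<nu> * (m z * f \<nu> (\<beta> * z))"
      unfolding t_Suc f_def using summ[OF \<nu> z'] by (simp add: suminf_mult summable_mult)
    finally show ?thesis by (simp add: t_def)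
  qed
  show "\<exists>C. \<forall>a b. (a, b) \<in> (\<lambda>\<nu>. (1, \<nu>)) ` cball 0 s \<longrightarrow>
      (\<exists>f. f holomorphic_on ball 0 1 \<and>
        (\<forall>z\<in>ball 0 1. a * f z - b * (m z * f (\<beta> * z)) = g z) \<and>
        (\<forall>z. norm z \<le> r0 \<longrightarrow> norm (f z) \<le> C))"
  proof (intro exI[of _ "\<Sum>n. D * q ^ n"] allI impI)
    fix a b assume "(a, b) \<in> (\<lambda>\<nu>. (1 :: complex, \<nu> :: complex)) ` cball 0 s"
    then have "a = 1" "norm b \<le> s" by auto
    then show "\<exists>f. f holomorphic_on ball 0 1 \<and>
        (\<forall>z\<in>ball 0 1. a * f z - b * (m z * f (\<beta> * z)) = g z) \<and>
        (\<forall>z. norm z \<le> r0 \<longrightarrow> norm (f z) \<le> (\<Sum>n. D * q ^ n))"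
      using hol eq bound by (intro exI[of _ "f b"]) auto
  qed
qed

text \<open>Writing \<open>\<mu> - T\<close> as \<open>\<mu> (1 - T / \<mu>)\<close> reduces this to
  the Neumann series with \<open>\<nu> = 1 / \<mu>\<close>.\<close>

lemma unif_solvable_exterior_zero_free:
  assumes m: "m holomorphic_on ball 0 1" "\<And>z. z \<in> ball 0 1 \<Longrightarrow> m z \<noteq> 0" and \<beta>: "norm \<beta> = 1"
    and aper: "\<And>n::nat. n \<ge> 1 \<Longrightarrow> \<beta> ^ n \<noteq> 1" and \<rho>: "norm (m 0) < \<rho>"
  shows "unif_solvable m \<beta> ((\<lambda>\<mu>. (\<mu>, 1)) ` {\<mu>. \<rho> \<le> norm \<mu>})"
proof (rule unif_solvable_scale[OF unif_solvable_neumann[OF m \<beta> aper, of "1 / \<rho>"], where B = "1 / \<rho>"])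
  have \<rho>0: "0 < \<rho>" using \<rho> norm_ge_zero[of "m 0"] by linarith
  show "0 \<le> 1 / \<rho>" "1 / \<rho> * norm (m 0) < 1" using \<rho> \<rho>0 by auto
  fix a b :: complex assume "(a, b) \<in> (\<lambda>\<mu>. (\<mu>, 1)) ` {\<mu>. \<rho> \<le> norm \<mu>}"
  then have ab: "\<rho> \<le> norm a" "b = 1" by auto
  then have "a \<noteq> 0" using \<rho>0 by auto
  moreover have "norm (1 / a) \<le> 1 / \<rho>"
    using ab \<rho>0 by (simp add: norm_divide frac_le)
  ultimately show "\<exists>c. c \<noteq> 0 \<and> (c * a, c * b) \<in> (\<lambda>\<nu>. (1, \<nu>)) ` cball 0 (1 / \<rho>)
      \<and> norm c \<le> 1 / \<rho>"
    using ab by (intro exI[of _ "1 / a"]) auto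
qed

text \<open>The inverse operator is the weighted rotation by \<open>\<beta>\<close> inverse with weight
  \<open>1 / m\<close> (rotated), and \<open>\<mu> - T\<close> is, up to sign and composition with \<open>T\<close>,
  the operator \<open>1 - \<mu> T\<^sup>-\<^sup>1\<close>.\<close>

lemma unif_solvable_interior_zero_free:
  assumes m: "m holomorphic_on ball 0 1" "\<And>z. z \<in> ball 0 1 \<Longrightarrow> m z \<noteq> 0" and \<beta>: "norm \<beta> = 1"
    and aper: "\<And>n::nat. n \<ge> 1 \<Longrightarrow> \<beta> ^ n \<noteq> 1" and \<rho>: "0 \<le> \<rho>" "\<rho> < norm (m 0)"
  shows "unif_solvable m \<beta> ((\<lambda>\<mu>. (\<mu>, 1)) ` cball 0 \<rho>)"
proof (rule unif_solvableI)
  fix g :: "complex \<Rightarrow> complex" and r :: real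
  assume g: "g holomorphic_on ball 0 1" and r: "0 < r" "r < 1"
  define \<gamma> where "\<gamma> = inverse \<beta>"
  have \<beta>0: "\<beta> \<noteq> 0" using \<beta> by auto
  have \<gamma>: "norm \<gamma> = 1" "\<beta> * \<gamma> = 1" "\<gamma> * \<beta> = 1" using \<beta> \<beta>0 by (auto simp: \<gamma>_def norm_inverse)
  define m' where "m' = (\<lambda>z. inverse (m (\<gamma> * z)))"
  have disc: "\<gamma> * z \<in> ball 0 1" if "z \<in> ball 0 1" for z using that by (simp add: norm_mult \<gamma>)
  have m': "m' holomorphic_on ball 0 1" "\<And>z. z \<in> ball 0 1 \<Longrightarrow> m' z \<noteq> 0"
    unfolding m'_def using m(2) disc
    by (auto intro!: holomorphic_on_inverse holomorphic_on_rotate m \<gamma>)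
  have aper': "\<gamma> ^ n \<noteq> 1" if "n \<ge> 1" for n :: nat
    using aper[OF that] by (simp add: \<gamma>_def power_inverse)
  have U: "unif_solvable m' \<gamma> ((\<lambda>\<nu>. (1, \<nu>)) ` cball 0 \<rho>)"
  proof (rule unif_solvable_neumann[OF m' \<gamma>(1) aper' \<rho>(1)])
    show "\<rho> * norm (m' 0) < 1"
      using \<rho> m(2)[of 0] by (simp add: m'_def norm_inverse flip: divide_inverse)
  qed
  \<comment> \<open>This is \<open>- T\<^sup>-\<^sup>1 g\<close>: applying \<open>T\<close> to
    \<open>(1 - \<mu> T\<^sup>-\<^sup>1) f = - T\<^sup>-\<^sup>1 g\<close> gives
    \<open>(\<mu> - T) f = g\<close>.\<close>
  define g' where "g' = (\<lambda>z. - (m' z * g (\<gamma> * z)))"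
  have "g' holomorphic_on ball 0 1"
    unfolding g'_def by (intro holomorphic_intros m' holomorphic_on_rotate g \<gamma>)
  then obtain C where C: "\<And>a b. (a, b) \<in> (\<lambda>\<nu>. (1, \<nu>)) ` cball 0 \<rho> \<Longrightarrow> \<exists>f. f holomorphic_on ball 0 1 \<and>
      (\<forall>z\<in>ball 0 1. a * f z - b * (m' z * f (\<gamma> * z)) = g' z) \<and>
      (\<forall>z. norm z \<le> r \<longrightarrow> norm (f z) \<le> C)"
    using unif_solvableD[OF U _ r] by blast
  have "\<exists>f. f holomorphic_on ball 0 1 \<and>
      (\<forall>z\<in>ball 0 1. \<mu> * f z - 1 * (m z * f (\<beta> * z)) = g z) \<and>
      (\<forall>z. norm z \<le> r \<longrightarrow> norm (f z) \<le> C)" if \<mu>: "\<mu> \<in> cball 0 \<rho>" for \<mu>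
  proof -
    obtain f where f: "f holomorphic_on ball 0 1"
      "\<And>z. z \<in> ball 0 1 \<Longrightarrow> 1 * f z - \<mu> * (m' z * f (\<gamma> * z)) = g' z"
      "\<forall>z. norm z \<le> r \<longrightarrow> norm (f z) \<le> C" using C[OF imageI[OF \<mu>]] by blast
    have "\<mu> * f z - 1 * (m z * f (\<beta> * z)) = g z" if z: "z \<in> ball 0 1" for z
    proof -
      have z': "\<beta> * z \<in> ball 0 1" using z by (simp add: norm_mult \<beta>)
      have \<gamma>z: "\<gamma> * (\<beta> * z) = z" by (simp add: \<gamma> flip: mult.assoc)
      have "f (\<beta> * z) - \<mu> * (inverse (m z) * f z) = - (inverse (m z) * g z)"
        using f(2)[OF z'] by (simp only: g'_def m'_def \<gamma>z mult_1)
      moreover have "m z * inverse (m z) = 1" using m(2)[OF z] by simp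
      ultimately show ?thesis by algebra
    qed
    with f show ?thesis by blast
  qed
  then show "\<exists>C. \<forall>a b. (a, b) \<in> (\<lambda>\<mu>. (\<mu>, 1)) ` cball 0 \<rho> \<longrightarrow>
      (\<exists>f. f holomorphic_on ball 0 1 \<and>
        (\<forall>z\<in>ball 0 1. a * f z - b * (m z * f (\<beta> * z)) = g z) \<and>
        (\<forall>z. norm z \<le> r \<longrightarrow> norm (f z) \<le> C))"
    by (intro exI[of _ C]) blast
qed

section \<open>The resolvent set of a weighted rotation\<close>

text \<open>In the coordinate \<open>w = 1 / \<mu>\<close> the exterior together with infinity is a
  disc, on which \<open>1 - w * m 0 * \<beta> ^ n\<close> never vanishes; the maximum principle
  applies there.\<close>

lemma unif_solvable_exterior:
  assumes m: "m holomorphic_on ball 0 1" and \<beta>: "norm \<beta> = 1" and \<rho>: "norm (m 0) < \<rho>"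
    and U: "unif_solvable m \<beta> ((\<lambda>\<mu>. (\<mu>, 1)) ` sphere 0 \<rho>)"
  shows "unif_solvable m \<beta> ((\<lambda>\<mu>. (\<mu>, 1)) ` {\<mu>. \<rho> \<le> norm \<mu>})"
proof -
  have \<rho>0: "0 < \<rho>" using \<rho> norm_ge_zero[of "m 0"] by linarith
  have "unif_solvable m \<beta> ((\<lambda>w. (1, w)) ` sphere 0 (1 / \<rho>))"
  proof (rule unif_solvable_scale[OF U, where B = \<rho>])
    fix a b :: complex assume "(a, b) \<in> (\<lambda>w. (1, w)) ` sphere 0 (1 / \<rho>)"
    then have ab: "a = 1" "norm b = 1 / \<rho>" by auto
    then have "b \<noteq> 0" using \<rho>0 by auto
    then show "\<exists>c. c \<noteq> 0 \<and> (c * a, c * b) \<in> (\<lambda>\<mu>. (\<mu>, 1)) ` sphere 0 \<rho> \<and> norm c \<le> \<rho>"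
      using ab by (intro exI[of _ "1 / b"]) (auto simp: norm_divide)
  qed
  then have "unif_solvable m \<beta> ((\<lambda>w. (1, w)) ` cball 0 (1 / \<rho>))"
  proof (intro unif_solvable_disc[where a = "\<lambda>_. 1" and b = "\<lambda>w. w"] m \<beta>)
    fix w :: complex and n assume w: "norm w \<le> 1 / \<rho>"
    have "norm (w * m 0 * \<beta> ^ n) \<le> 1 / \<rho> * norm (m 0)"
      using mult_right_mono[OF w, of "norm (m 0)"] by (simp add: norm_mult norm_power \<beta>)
    also have "\<dots> < 1" using \<rho> \<rho>0 by simp
    finally show "1 - w * m 0 * \<beta> ^ n \<noteq> 0" by auto
  qed (use \<rho>0 in auto)
  then show ?thesis
  proof (rule unif_solvable_scale[where B = "1 / \<rho>"])
    fix a b :: complex assume "(a, b) \<in> (\<lambda>\<mu>. (\<mu>, 1)) ` {\<mu>. \<rho> \<le> norm \<mu>}"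
    then have ab: "\<rho> \<le> norm a" "b = 1" by auto
    then have "a \<noteq> 0" using \<rho>0 by auto
    moreover have "norm (1 / a) \<le> 1 / \<rho>"
      using ab \<rho>0 by (simp add: norm_divide frac_le)
    ultimately show "\<exists>c. c \<noteq> 0 \<and> (c * a, c * b) \<in> (\<lambda>\<nu>. (1, \<nu>)) ` cball 0 (1 / \<rho>)
        \<and> norm c \<le> 1 / \<rho>"
      using ab by (intro exI[of _ "1 / a"]) auto
  qed
qed

lemma unif_solvable_imp_solvable:
  assumes "unif_solvable m \<beta> P" "(a, b) \<in> P" "g holomorphic_on ball 0 1"
  obtains f where "f holomorphic_on ball 0 1"
    "\<And>z. z \<in> ball 0 1 \<Longrightarrow> a * f z - b * (m z * f (\<beta> * z)) = g z"
proof -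
  obtain C where "\<And>a b. (a, b) \<in> P \<Longrightarrow> \<exists>f. f holomorphic_on ball 0 1 \<and>
      (\<forall>z\<in>ball 0 1. a * f z - b * (m z * f (\<beta> * z)) = g z) \<and>
      (\<forall>z. norm z \<le> 1 / 2 \<longrightarrow> norm (f z) \<le> C)"
    by (rule unif_solvableD[OF assms(1,3), of "1 / 2"]) auto
  from this[OF assms(2)] show ?thesis using that by blast
qed

text \<open>At \<open>\<mu> = 0\<close> the equation with right-hand side 1 makes \<open>m z\<close>
  a factor of \<open>-1\<close>.\<close>

lemma unif_solvable_imp_zero_free:
  assumes U: "unif_solvable m \<beta> P" "(0, 1) \<in> P" and z: "z \<in> ball 0 1"
  shows "m z \<noteq> 0"
proof -
  obtain f where "\<And>z. z \<in> ball 0 1 \<Longrightarrow> 0 * f z - 1 * (m z * f (\<beta> * z)) = 1"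
    by (rule unif_solvable_imp_solvable[OF U holomorphic_on_const[of 1]]) blast
  from this[OF z] show ?thesis by force
qed

lemma unif_solvable_interior:
  assumes m: "m holomorphic_on ball 0 1" and \<beta>: "norm \<beta> = 1" and \<rho>: "0 < \<rho>" "\<rho> < norm (m 0)"
    and U: "unif_solvable m \<beta> ((\<lambda>\<mu>. (\<mu>, 1)) ` sphere 0 \<rho>)"
  shows "unif_solvable m \<beta> ((\<lambda>\<mu>. (\<mu>, 1)) ` cball 0 \<rho>)"
proof (rule unif_solvable_disc[where a = "\<lambda>w. w" and b = "\<lambda>_. 1", OF m \<beta> \<rho>(1) _ _ _ U])
  fix w :: complex and n assume "norm w \<le> \<rho>"
  then have "norm w < norm (m 0 * \<beta> ^ n)" using \<rho> by (simp add: norm_mult norm_power \<beta>)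
  then show "w - 1 * m 0 * \<beta> ^ n \<noteq> 0" by auto
qed auto

text \<open>Solvability for all right-hand sides excludes the diagonal values, so uniqueness of
  solutions comes with existence.\<close>

lemma unif_solvable_nonresonant:
  assumes U: "unif_solvable m \<beta> P" and m: "m holomorphic_on ball 0 1" and ab: "(a, b) \<in> P"
  shows "a - b * m 0 * \<beta> ^ n \<noteq> 0"
proof
  assume "a - b * m 0 * \<beta> ^ n = 0"
  then obtain g where g: "g holomorphic_on ball 0 1"
    "\<nexists>f. f holomorphic_on ball 0 1 \<and> (\<forall>z\<in>ball 0 1. a * f z - b * (m z * f (\<beta> * z)) = g z)"
    using not_solvable_resonance[OF m] by blast
  show False
    by (rule unif_solvable_imp_solvable[OF U ab g(1)]) (use g(2) in blast)
qed

text \<open>If \<open>m\<close> does not vanish on a circle, the maximum principle bounds the solution of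
  \<open>(\<mu> - T) f = 1\<close> at the origin for small \<open>\<mu>\<close>, where its value is \<open>1 / \<mu>\<close>.\<close>

lemma not_unif_solvable_punctured:
  assumes m: "m holomorphic_on ball 0 1" "m 0 = 0" "\<exists>z\<in>ball 0 1. m z \<noteq> 0" and \<beta>: "norm \<beta> = 1"
  obtains \<mu> where "\<mu> \<noteq> 0" "\<And>P. (\<mu>, 1) \<in> P \<Longrightarrow> \<not> unif_solvable m \<beta> P"
proof -
  obtain z1 where z1: "z1 \<in> ball 0 1" "m z1 \<noteq> 0" using m(3) by blast
  obtain r0 where r0: "0 < r0" "\<And>z. z \<in> ball 0 r0 - {0} \<Longrightarrow> m z \<noteq> 0"
    by (rule isolated_zeros[OF m(1) open_ball connected_ball _ m(2) z1]) auto
  define r where "r = min (r0 / 2) (1 / 2)"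
  have r: "0 < r" "r < 1" "r < r0" using r0 by (auto simp: r_def)
  have sub: "cball (0 :: complex) r \<subseteq> ball 0 1" "sphere (0 :: complex) r \<subseteq> ball 0 1" using r by auto
  have ne: "sphere (0 :: complex) r \<noteq> {}" using r by simp
  have "continuous_on (sphere 0 r) (\<lambda>z. norm (m z))"
    by (intro continuous_intros continuous_on_subset[OF holomorphic_on_imp_continuous_on[OF m(1)]] sub)
  from continuous_attains_inf[OF compact_sphere ne this]
  obtain z2 where z2: "norm z2 = r" "\<And>z. norm z = r \<Longrightarrow> norm (m z2) \<le> norm (m z)" by auto
  define c where "c = norm (m z2)"
  have c: "0 < c" using r0(2)[of z2] z2(1) r by (auto simp: c_def)
  \<comment> \<open>With \<open>X\<close> the maximum of \<open>norm (f z)\<close> on the circle,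
    the equation gives \<open>c * X \<le> c / 4 * X + 1\<close>, hence
    \<open>c * X \<le> 4 / 3\<close>, while \<open>f 0 = 1 / \<mu>\<close> gives
    \<open>c * norm (f 0) = 4\<close>. The two contradict the maximum principle.\<close>
  define \<mu> where "\<mu> = complex_of_real (c / 4)"
  have n\<mu>: "norm \<mu> = c / 4" using c by (simp add: \<mu>_def)
  have "False" if U: "unif_solvable m \<beta> P" and P: "(\<mu>, 1) \<in> P" for P
  proof -
    obtain f where f: "f holomorphic_on ball 0 1"
      "\<And>z. z \<in> ball 0 1 \<Longrightarrow> \<mu> * f z - 1 * (m z * f (\<beta> * z)) = 1"
      by (rule unif_solvable_imp_solvable[OF U P holomorphic_on_const[of 1]]) blast
    have cont: "continuous_on (cball 0 r) f"
      by (intro continuous_on_subset[OF holomorphic_on_imp_continuous_on[OF f(1)]] sub)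
    have "continuous_on (sphere 0 r) (\<lambda>z. norm (f z))"
      by (intro continuous_intros continuous_on_subset[OF cont]) auto
    from continuous_attains_sup[OF compact_sphere ne this]
    obtain x where x: "norm x = r" "\<And>z. norm z = r \<Longrightarrow> norm (f z) \<le> norm (f x)" by auto
    define X where "X = norm (f x)"
    define z where "z = x / \<beta>"
    have z: "norm z = r" "\<beta> * z = x" using x(1) \<beta> by (auto simp: z_def norm_divide)
    have "c * X \<le> norm (m z * f x)"
      using z2(2)[OF z(1)] by (simp add: norm_mult X_def c_def mult_right_mono)
    also have "m z * f x = \<mu> * f z - 1"
      using f(2)[of z] z r by (simp add: algebra_simps)
    also have "norm \<dots> \<le> norm (\<mu> * f z) + 1" using norm_triangle_ineq4[of "\<mu> * f z" 1] by simp
    also have "norm (\<mu> * f z) \<le> c / 4 * X"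
      unfolding norm_mult n\<mu> X_def using x(2)[OF z(1)] c by (intro mult_left_mono) auto
    finally have X: "3 * (c * X) \<le> 4" by (simp add: field_simps)
    have "norm (f 0) \<le> X"
    proof (rule maximum_modulus_frontier[of f "cball 0 r"])
      show "f holomorphic_on interior (cball 0 r)"
        using sub interior_subset by (intro holomorphic_on_subset[OF f(1)]) blast
      show "continuous_on (closure (cball 0 r)) f" using cont by simp
      show "norm (f w) \<le> X" if "w \<in> frontier (cball 0 r)" for w
        using that r x(2) by (simp add: X_def)
    qed (use r in auto)
    moreover have "\<mu> * f 0 = 1" using f(2)[of 0] m(2) by simp
    then have "c / 4 * norm (f 0) = 1" using n\<mu> by (metis norm_mult norm_one)
    then have "c * norm (f 0) = 4" by simp
    ultimately have "4 \<le> c * X" using c by (metis mult_left_mono less_imp_le)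
    with X show False by simp
  qed
  moreover have "\<mu> \<noteq> 0" using n\<mu> c by auto
  ultimately show ?thesis using that by blast
qed

section \<open>Shape of the Waelbroeck resolvent set of a weighted rotation\<close>

context
  fixes m :: "complex \<Rightarrow> complex" and \<beta> :: complex and W :: "complex set"
  assumes m: "m holomorphic_on ball 0 1" and nontriv: "\<exists>z\<in>ball 0 1. m z \<noteq> 0"
    and \<beta>: "norm \<beta> = 1" and aper: "\<And>n::nat. n \<ge> 1 \<Longrightarrow> \<beta> ^ n \<noteq> 1"
    and W: "\<And>l. l \<in> W \<longleftrightarrow> (\<exists>\<delta>>0. unif_solvable m \<beta> ((\<lambda>\<mu>. (\<mu>, 1)) ` cball l \<delta>))"
begin

text \<open>The diagonal values \<open>m 0 * \<beta> ^ n\<close> are dense in this circle, so every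
  disc about \<open>l\<close> contains one, at which the operator is not onto.\<close>

lemma rotation_resolvent_avoids_circle:
  assumes l: "l \<in> W"
  shows "norm l \<noteq> norm (m 0)"
proof
  assume eq: "norm l = norm (m 0)"
  obtain \<delta> where \<delta>: "0 < \<delta>" "unif_solvable m \<beta> ((\<lambda>\<mu>. (\<mu>, 1)) ` cball l \<delta>)"
    using W l by blast
  have "\<exists>n. m 0 * \<beta> ^ n \<in> cball l \<delta>"
  proof (cases "m 0 = 0")
    case True
    then show ?thesis using eq \<delta> by simp
  next
    case False
    then have "norm (l / m 0) = 1" using eq by (simp add: norm_divide)
    then obtain n where "norm (\<beta> ^ n - l / m 0) < \<delta> / norm (m 0)"
      using dense_powers_on_circle[OF \<beta> aper, of "l / m 0" "\<delta> / norm (m 0)"] \<delta>(1) False by auto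
    then have "norm (m 0 * (\<beta> ^ n - l / m 0)) < \<delta>"
      using False by (simp add: norm_mult pos_less_divide_eq mult.commute)
    then have "m 0 * \<beta> ^ n \<in> cball l \<delta>"
      using False by (simp add: dist_norm norm_minus_commute right_diff_distrib)
    then show ?thesis ..
  qed
  then obtain n where "(m 0 * \<beta> ^ n, 1 :: complex) \<in> (\<lambda>\<mu>. (\<mu>, 1)) ` cball l \<delta>" by blast
  from unif_solvable_nonresonant[OF \<delta>(2) m this, of n] show False by simp
qed

lemma exterior_in_rotation_resolvent:
  assumes U: "unif_solvable m \<beta> ((\<lambda>\<mu>. (\<mu>, 1)) ` {\<mu>. \<rho> \<le> norm \<mu>})" and l: "\<rho> < norm l"
  shows "l \<in> W"
proof -
  have "cball l (norm l - \<rho>) \<subseteq> {\<mu>. \<rho> \<le> norm \<mu>}"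
  proof
    fix \<mu> assume "\<mu> \<in> cball l (norm l - \<rho>)"
    then show "\<mu> \<in> {\<mu>. \<rho> \<le> norm \<mu>}"
      using norm_triangle_ineq2[of l \<mu>] by (simp add: dist_norm)
  qed
  then have "unif_solvable m \<beta> ((\<lambda>\<mu>. (\<mu>, 1)) ` cball l (norm l - \<rho>))"
    by (intro unif_solvable_mono[OF U] image_mono)
  then show ?thesis unfolding W using l by (intro exI[of _ "norm l - \<rho>"]) simp
qed

text \<open>The circle through a point \<open>l'\<close> slightly closer to the origin than
  \<open>l\<close> is used, so that the radius obtained is strictly below
  \<open>norm l\<close>.\<close>

lemma rotation_resolvent_upward:
  assumes l: "l \<in> W" and big: "norm (m 0) < norm l"
  obtains \<rho> where "0 \<le> \<rho>" "\<rho> < norm l" "\<And>\<nu>. \<rho> < norm \<nu> \<Longrightarrow> \<nu> \<in> W"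
proof -
  obtain \<delta> where \<delta>: "0 < \<delta>" "unif_solvable m \<beta> ((\<lambda>\<mu>. (\<mu>, 1)) ` cball l \<delta>)"
    using W l by blast
  have l0: "norm l > 0" using big norm_ge_zero[of "m 0"] by linarith
  \<comment> \<open>The first bound keeps \<open>cball l' (\<delta> / 2)\<close> inside
    \<open>cball l \<delta>\<close>, the second keeps \<open>l'\<close> outside the critical
    circle.\<close>
  define e where "e = min (\<delta> / 2) ((norm l - norm (m 0)) / 2)"
  have e: "0 < e" "e \<le> \<delta> / 2" "e < norm l - norm (m 0)"
    using \<delta>(1) big unfolding e_def by (auto simp: min_less_iff_disj)
  define t where "t = 1 - e / norm l"
  define l' where "l' = of_real t * l"
  have tl: "t * norm l = norm l - e" using l0 by (simp add: t_def field_simps)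
  have "e < norm l" using e(3) norm_ge_zero[of "m 0"] by linarith
  then have t: "0 < t" using l0 by (simp add: t_def)
  have nl': "norm l' = norm l - e" using t tl by (simp add: l'_def norm_mult)
  have "l - l' = of_real (e / norm l) * l" by (simp add: l'_def t_def algebra_simps)
  then have "dist l l' = norm (of_real (e / norm l) * l)" by (simp only: dist_norm)
  also have "\<dots> = e" unfolding norm_mult norm_of_real using e l0 by simp
  finally have dl: "dist l l' = e" .
  have "cball l' (\<delta> / 2) \<subseteq> cball l \<delta>"
    using dl e(2) by (intro cball_subset_cball_iff[THEN iffD2]) (simp add: dist_commute)
  then have "unif_solvable m \<beta> ((\<lambda>\<mu>. (\<mu>, 1)) ` cball l' (\<delta> / 2))"
    by (intro unif_solvable_mono[OF \<delta>(2)] image_mono)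
  moreover have "l' \<noteq> 0" "norm l' \<noteq> norm (m 0)" "0 < \<delta> / 2"
    using nl' e \<delta>(1) norm_ge_zero[of "m 0"] by auto
  ultimately have "unif_solvable m \<beta> ((\<lambda>\<mu>. (\<mu>, 1)) ` sphere 0 (norm l'))"
    using unif_solvable_circle[OF m \<beta> aper] by blast
  then have "unif_solvable m \<beta> ((\<lambda>\<mu>. (\<mu>, 1)) ` {\<mu>. norm l' \<le> norm \<mu>})"
    using nl' e by (intro unif_solvable_exterior[OF m \<beta>]) auto
  then have "\<nu> \<in> W" if "norm l' < norm \<nu>" for \<nu>
    using exterior_in_rotation_resolvent that by blast
  then show ?thesis using that[of "norm l'"] nl' e \<open>e < norm l\<close> by simp
qed

text \<open>Solvability spreads from a disc about \<open>l\<close> to the circle through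
  \<open>l\<close>, then to its interior, and so reaches \<open>\<mu> = 0\<close>, where it excludes
  zeros of \<open>m\<close>.\<close>

lemma rotation_resolvent_interior_zero_free:
  assumes l: "l \<in> W" and small: "norm l < norm (m 0)" and z: "z \<in> ball 0 1"
  shows "m z \<noteq> 0"
proof -
  obtain \<delta> where \<delta>: "0 < \<delta>" "unif_solvable m \<beta> ((\<lambda>\<mu>. (\<mu>, 1)) ` cball l \<delta>)"
    using W l by blast
  show ?thesis
  proof (cases "l = 0")
    case True
    then show ?thesis using unif_solvable_imp_zero_free[OF \<delta>(2) _ z] \<delta>(1) by auto
  next
    case False
    then have "unif_solvable m \<beta> ((\<lambda>\<mu>. (\<mu>, 1)) ` sphere 0 (norm l))"
      using unif_solvable_circle[OF m \<beta> aper _ _ \<delta>] small by simp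
    then have "unif_solvable m \<beta> ((\<lambda>\<mu>. (\<mu>, 1)) ` cball 0 (norm l))"
      using False small by (intro unif_solvable_interior[OF m \<beta>]) auto
    then show ?thesis by (rule unif_solvable_imp_zero_free[OF _ _ z]) auto
  qed
qed

lemma rotation_resolvent_zero_free:
  assumes nz: "\<And>z. z \<in> ball 0 1 \<Longrightarrow> m z \<noteq> 0"
  shows "W = {l. norm l \<noteq> norm (m 0)}"
proof (intro equalityI subsetI CollectI)
  fix l :: complex assume "l \<in> {l. norm l \<noteq> norm (m 0)}"
  then consider "norm l < norm (m 0)" | "norm (m 0) < norm l" by force
  then show "l \<in> W"
  proof cases
    case 1
    define \<rho> where "\<rho> = (norm l + norm (m 0)) / 2"
    have \<rho>: "0 \<le> \<rho>" "\<rho> < norm (m 0)" "norm l < \<rho>" using 1 by (auto simp: \<rho>_def)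
    have "cball l (\<rho> - norm l) \<subseteq> cball 0 \<rho>"
      by (intro cball_subset_cball_iff[THEN iffD2]) (simp add: dist_norm)
    then have "unif_solvable m \<beta> ((\<lambda>\<mu>. (\<mu>, 1)) ` cball l (\<rho> - norm l))"
      by (intro unif_solvable_mono[OF unif_solvable_interior_zero_free[OF m nz \<beta> aper \<rho>(1,2)]]
          image_mono)
    then show ?thesis unfolding W using \<rho>(3) by (intro exI[of _ "\<rho> - norm l"]) simp
  next
    case 2
    define \<rho> where "\<rho> = (norm l + norm (m 0)) / 2"
    have \<rho>: "norm (m 0) < \<rho>" "\<rho> < norm l" using 2 by (auto simp: \<rho>_def)
    show ?thesis
      by (rule exterior_in_rotation_resolvent[OF unif_solvable_exterior_zero_free[OF m nz \<beta> aper \<rho>(1)] \<rho>(2)])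
  qed
qed (rule rotation_resolvent_avoids_circle)

lemma rotation_resolvent_with_zero:
  assumes zero: "\<exists>z0\<in>ball 0 1. m z0 = 0"
  shows "(\<exists>R>0. W = {l. R < norm l}) \<or> W = {}"
proof (cases "W = {}")
  case False
  have big: "norm (m 0) < norm l" if "l \<in> W" for l
    using rotation_resolvent_interior_zero_free[OF that] rotation_resolvent_avoids_circle[OF that]
      zero by fastforce
  \<comment> \<open>\<open>A\<close> holds the radii whose open exterior lies in \<open>W\<close>.
    Each \<open>l\<close> in \<open>W\<close> has such a radius strictly below
    \<open>norm l\<close>, so \<open>W\<close> is the open exterior of the disc of radius
    \<open>Inf A\<close>.\<close>
  define A where "A = {\<rho>. 0 \<le> \<rho> \<and> (\<forall>\<nu>. \<rho> < norm \<nu> \<longrightarrow> \<nu> \<in> W)}"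
  have upw: "\<exists>\<rho>\<in>A. \<rho> < norm l" if "l \<in> W" for l
    using rotation_resolvent_upward[OF that big[OF that]] unfolding A_def by blast
  then have A: "A \<noteq> {}" "bdd_below A" using False unfolding A_def by (auto intro: bdd_belowI[of _ 0])
  define R where "R = Inf A"
  have WR: "W = {l. R < norm l}"
  proof (intro equalityI subsetI CollectI)
    fix l :: complex assume "l \<in> W"
    then obtain \<rho> where "\<rho> \<in> A" "\<rho> < norm l" using upw by blast
    then show "R < norm l" using cInf_lower[OF _ A(2)] unfolding R_def by fastforce
  next
    fix l :: complex assume "l \<in> {l. R < norm l}"
    then obtain \<rho> where "\<rho> \<in> A" "\<rho> < norm l" unfolding R_def using cInf_lessD[OF A(1)] by blast
    then show "l \<in> W" unfolding A_def by blast
  qed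
  have "R \<ge> 0" unfolding R_def by (rule cInf_greatest[OF A(1)]) (simp add: A_def)
  \<comment> \<open>If \<open>R = 0\<close>, every nonzero point lies in \<open>W\<close>. Since
    \<open>W\<close> avoids the circle through \<open>m 0\<close>, this forces
    \<open>m 0 = 0\<close>, and then some nonzero \<open>\<mu>\<close> is known not to be in
    \<open>W\<close>.\<close>
  moreover have "R \<noteq> 0"
  proof
    assume R0: "R = 0"
    then have "m 0 = 0" using big[of "m 0"] unfolding WR by auto
    then obtain \<mu> where \<mu>: "\<mu> \<noteq> 0" "\<And>P. (\<mu>, 1) \<in> P \<Longrightarrow> \<not> unif_solvable m \<beta> P"
      using not_unif_solvable_punctured[OF m _ nontriv \<beta>] by metis
    then have "\<mu> \<in> W" unfolding WR R0 by simp
    then obtain \<delta> where "0 < \<delta>" "unif_solvable m \<beta> ((\<lambda>\<mu>. (\<mu>, 1)) ` cball \<mu> \<delta>)" using W by blast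
    then show False using \<mu>(2)[of "(\<lambda>\<mu>. (\<mu>, 1)) ` cball \<mu> \<delta>"] by auto
  qed
  ultimately have "R > 0" by simp
  then show ?thesis using WR by blast
qed simp

end

section \<open>Conjugation by the disc automorphism\<close>

lemma one_minus_cnj_mult_nonzero:
  assumes "norm \<alpha> < 1" "norm z < 1"
  shows "1 - cnj \<alpha> * z \<noteq> 0"
proof
  assume "1 - cnj \<alpha> * z = 0"
  then have "norm (cnj \<alpha> * z) = 1" by simp
  then show False using norm_mult_less[of "cnj \<alpha>" 1 z 1] assms by simp
qed

context
  fixes \<alpha> :: complex
  assumes \<alpha>: "norm \<alpha> < 1"
begin

lemma Psi_in_disc: "z \<in> ball 0 1 \<Longrightarrow> Psi \<alpha> z \<in> ball 0 1"
  using Moebius_function_norm_lt_1[of \<alpha> z 0] \<alpha>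
  by (simp add: Moebius_function_simple Psi_def norm_divide norm_minus_commute)

lemma holomorphic_Psi: "Psi \<alpha> holomorphic_on ball 0 1"
  unfolding Psi_def[abs_def] using one_minus_cnj_mult_nonzero[OF \<alpha>]
  by (intro holomorphic_intros) auto

lemma Psi_Psi:
  assumes "z \<in> ball 0 1"
  shows "Psi \<alpha> (Psi \<alpha> z) = z"
proof -
  have nz: "1 - cnj \<alpha> * z \<noteq> 0" "1 - cnj \<alpha> * \<alpha> \<noteq> 0"
    using one_minus_cnj_mult_nonzero[OF \<alpha>] \<alpha> assms by auto
  have "Psi \<alpha> (Psi \<alpha> z) = ((1 - cnj \<alpha> * \<alpha>) * z) / (1 - cnj \<alpha> * \<alpha>)"
    using nz unfolding Psi_def by (simp add: divide_simps) (simp add: algebra_simps)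
  then show ?thesis using nz by simp
qed

lemma holomorphic_comp_Psi:
  "f holomorphic_on ball 0 1 \<Longrightarrow> (f \<circ> Psi \<alpha>) holomorphic_on ball 0 1"
  by (rule holomorphic_on_compose_gen[OF holomorphic_Psi]) (use Psi_in_disc in auto)

text \<open>By compactness the image of a smaller closed disc stays in another one, so bounds on all
  smaller discs survive composition with \<open>Psi \<alpha>\<close>.\<close>

lemma Psi_cball:
  assumes "0 < r" "r < 1"
  obtains s where "0 < s" "s < 1" "\<And>z. norm z \<le> r \<Longrightarrow> norm (Psi \<alpha> z) \<le> s"
proof -
  have sub: "cball (0 :: complex) r \<subseteq> ball 0 1" using assms by auto
  have "continuous_on (cball 0 r) (\<lambda>z. norm (Psi \<alpha> z))"
    by (intro continuous_intros holomorphic_on_imp_continuous_on holomorphic_on_subset[OF holomorphic_Psi sub])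
  from continuous_attains_sup[OF compact_cball _ this] assms
  obtain x where x: "norm x \<le> r" "\<And>z. norm z \<le> r \<Longrightarrow> norm (Psi \<alpha> z) \<le> norm (Psi \<alpha> x)" by auto
  have "norm (Psi \<alpha> x) < 1" using Psi_in_disc[of x] x(1) assms by simp
  then show ?thesis
    using that[of "max (norm (Psi \<alpha> x)) (1 / 2)"] x(2) by (simp add: le_max_iff_disj)
qed

end

section \<open>Transfer between the weighted composition operator and the weighted rotation\<close>

context
  fixes \<alpha> \<beta> :: complex and m \<phi> M :: "complex \<Rightarrow> complex"
  assumes \<alpha>: "norm \<alpha> < 1" and \<beta>: "norm \<beta> = 1" and m: "m holomorphic_on ball 0 1"
  defines "\<phi> \<equiv> Psi \<alpha> \<circ> (\<lambda>z. \<beta> * z) \<circ> Psi \<alpha>" and "M \<equiv> m \<circ> Psi \<alpha>"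
begin

text \<open>\<open>Psi \<alpha>\<close> is an involution of the disc, so the equation may be read at
  \<open>Psi \<alpha> z\<close> instead of \<open>z\<close>.\<close>

lemma weighted_comp_eq_rotation:
  "(\<forall>z\<in>ball 0 1. \<mu> * f z - weighted_comp m \<phi> f z = g z) \<longleftrightarrow>
   (\<forall>z\<in>ball 0 1. \<mu> * (f \<circ> Psi \<alpha>) z - 1 * (M z * (f \<circ> Psi \<alpha>) (\<beta> * z)) = (g \<circ> Psi \<alpha>) z)"
proof -
  have "(\<forall>z\<in>ball 0 1. P z) \<longleftrightarrow> (\<forall>z\<in>ball 0 1. P (Psi \<alpha> z))" for P
    using Psi_in_disc[OF \<alpha>] Psi_Psi[OF \<alpha>] by metis
  from this[of "\<lambda>z. \<mu> * f z - weighted_comp m \<phi> f z = g z"] show ?thesis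
    by (simp add: weighted_comp_def \<phi>_def M_def Psi_Psi[OF \<alpha>])
qed

lemma holomorphic_M: "M holomorphic_on ball 0 1"
  unfolding M_def by (rule holomorphic_comp_Psi[OF \<alpha> m])

lemma M_zero: "M 0 = m \<alpha>"
  by (simp add: M_def Psi_def)

text \<open>Composing twice with \<open>Psi \<alpha>\<close> is guaranteed to return
  \<open>f\<close> only on the disc, so the equation is carried over pointwise.\<close>

lemma rotation_eq_comp_Psi:
  assumes "\<forall>z\<in>ball 0 1. a * f z - b * (M z * f (\<beta> * z)) = g z"
  shows "\<forall>z\<in>ball 0 1. a * (f \<circ> Psi \<alpha> \<circ> Psi \<alpha>) z - b * (M z * (f \<circ> Psi \<alpha> \<circ> Psi \<alpha>) (\<beta> * z)) = g z"
  using assms Psi_Psi[OF \<alpha>] by (simp add: norm_mult \<beta>)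

text \<open>The left side asks for bijectivity and for a bound on every solution, the right side for
  one bounded solution per parameter. They agree because nonresonance makes the solution
  unique.\<close>

lemma waelbroeck_resolvent_set_iff:
  "l \<in> waelbroeck_resolvent_set (weighted_comp m \<phi>) \<longleftrightarrow>
    (\<exists>\<delta>>0. unif_solvable M \<beta> ((\<lambda>\<mu>. (\<mu>, 1)) ` cball l \<delta>))"
proof
  assume "l \<in> waelbroeck_resolvent_set (weighted_comp m \<phi>)"
  then obtain \<delta> where \<delta>: "\<delta> > 0" "cball l \<delta> \<subseteq> resolvent_set (weighted_comp m \<phi>)"
    and bd: "\<And>g r. g \<in> hol_disc \<Longrightarrow> 0 < r \<Longrightarrow> r < 1 \<Longrightarrow>
          (\<exists>C. \<forall>\<mu>\<in>cball l \<delta>. \<forall>f\<in>hol_disc.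
              (\<forall>z\<in>ball 0 1. \<mu> * f z - weighted_comp m \<phi> f z = g z) \<longrightarrow>
              (\<forall>z. norm z \<le> r \<longrightarrow> norm (f z) \<le> C))"
    unfolding waelbroeck_resolvent_set_def by blast
  have "unif_solvable M \<beta> ((\<lambda>\<mu>. (\<mu>, 1)) ` cball l \<delta>)"
  proof (rule unif_solvableI)
    fix g and r :: real assume g: "g holomorphic_on ball 0 1" and r: "0 < r" "r < 1"
    obtain s where s: "0 < s" "s < 1" "\<And>z. norm z \<le> r \<Longrightarrow> norm (Psi \<alpha> z) \<le> s"
      using Psi_cball[OF \<alpha> r] by blast
    have g': "g \<circ> Psi \<alpha> \<in> hol_disc" using holomorphic_comp_Psi[OF \<alpha> g] by (simp add: hol_disc_def)
    obtain C where C: "\<And>\<mu> f z. \<mu> \<in> cball l \<delta> \<Longrightarrow> f \<in> hol_disc \<Longrightarrow>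
        (\<forall>z\<in>ball 0 1. \<mu> * f z - weighted_comp m \<phi> f z = (g \<circ> Psi \<alpha>) z) \<Longrightarrow>
        norm z \<le> s \<Longrightarrow> norm (f z) \<le> C"
      using bd[OF g' s(1,2)] by blast
    have "\<exists>f. f holomorphic_on ball 0 1 \<and>
        (\<forall>z\<in>ball 0 1. \<mu> * f z - 1 * (M z * f (\<beta> * z)) = g z) \<and>
        (\<forall>z. norm z \<le> r \<longrightarrow> norm (f z) \<le> C)" if \<mu>: "\<mu> \<in> cball l \<delta>" for \<mu>
    proof -
      have "\<mu> \<in> resolvent_set (weighted_comp m \<phi>)" using \<mu> \<delta>(2) by blast
      then obtain f where f: "f \<in> hol_disc"
          "\<forall>z\<in>ball 0 1. \<mu> * f z - weighted_comp m \<phi> f z = (g \<circ> Psi \<alpha>) z"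
        unfolding resolvent_set_def using g' by blast
      have "\<forall>z\<in>ball 0 1. \<mu> * (f \<circ> Psi \<alpha>) z - 1 * (M z * (f \<circ> Psi \<alpha>) (\<beta> * z)) = g z"
        using f(2)[unfolded weighted_comp_eq_rotation] by (simp add: Psi_Psi[OF \<alpha>])
      moreover have "(f \<circ> Psi \<alpha>) holomorphic_on ball 0 1"
        using holomorphic_comp_Psi[OF \<alpha>] f(1) by (simp add: hol_disc_def)
      moreover have "\<forall>z. norm z \<le> r \<longrightarrow> norm ((f \<circ> Psi \<alpha>) z) \<le> C"
        using C[OF \<mu> f s(3)] by simp
      ultimately show ?thesis by blast
    qed
    then show "\<exists>C. \<forall>a b. (a, b) \<in> (\<lambda>\<mu>. (\<mu>, 1)) ` cball l \<delta> \<longrightarrow>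
        (\<exists>f. f holomorphic_on ball 0 1 \<and>
          (\<forall>z\<in>ball 0 1. a * f z - b * (M z * f (\<beta> * z)) = g z) \<and>
          (\<forall>z. norm z \<le> r \<longrightarrow> norm (f z) \<le> C))"
      by (intro exI[of _ C]) blast
  qed
  with \<delta>(1) show "\<exists>\<delta>>0. unif_solvable M \<beta> ((\<lambda>\<mu>. (\<mu>, 1)) ` cball l \<delta>)" by blast
next
  assume "\<exists>\<delta>>0. unif_solvable M \<beta> ((\<lambda>\<mu>. (\<mu>, 1)) ` cball l \<delta>)"
  then obtain \<delta> where \<delta>: "\<delta> > 0" and U: "unif_solvable M \<beta> ((\<lambda>\<mu>. (\<mu>, 1)) ` cball l \<delta>)" by blast
  have uniq: "f1 z = f2 z"
    if \<mu>: "\<mu> \<in> cball l \<delta>" and f: "f1 holomorphic_on ball 0 1" "f2 holomorphic_on ball 0 1"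
      and eq: "\<forall>z\<in>ball 0 1. \<mu> * f1 z - 1 * (M z * f1 (\<beta> * z)) = g z"
        "\<forall>z\<in>ball 0 1. \<mu> * f2 z - 1 * (M z * f2 (\<beta> * z)) = g z"
      and z: "z \<in> ball 0 1" for \<mu> f1 f2 g z
  proof (rule solution_unique[OF f holomorphic_M \<beta> _ _ z])
    show "\<mu> - 1 * M 0 * \<beta> ^ n \<noteq> 0" for n
      by (rule unif_solvable_nonresonant[OF U holomorphic_M]) (use \<mu> in auto)
  qed (use eq in simp)
  have res: "cball l \<delta> \<subseteq> resolvent_set (weighted_comp m \<phi>)"
  proof
    fix \<mu> assume \<mu>: "\<mu> \<in> cball l \<delta>"
    have "\<exists>f\<in>hol_disc. \<forall>z\<in>ball 0 1. \<mu> * f z - weighted_comp m \<phi> f z = g z"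
      if g: "g \<in> hol_disc" for g
    proof -
      have "(g \<circ> Psi \<alpha>) holomorphic_on ball 0 1"
        using g holomorphic_comp_Psi[OF \<alpha>] by (simp add: hol_disc_def)
      then obtain f where f: "f holomorphic_on ball 0 1"
        "\<forall>z\<in>ball 0 1. \<mu> * f z - 1 * (M z * f (\<beta> * z)) = (g \<circ> Psi \<alpha>) z"
        by (rule unif_solvable_imp_solvable[OF U imageI[OF \<mu>]]) blast
      have "f \<circ> Psi \<alpha> \<in> hol_disc" using f(1) holomorphic_comp_Psi[OF \<alpha>] by (simp add: hol_disc_def)
      then show ?thesis
        using rotation_eq_comp_Psi[OF f(2), folded weighted_comp_eq_rotation] by blast
    qed
    moreover have "f1 z = f2 z" if f: "f1 \<in> hol_disc" "f2 \<in> hol_disc"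
      and eq: "\<forall>z\<in>ball 0 1. \<mu> * f1 z - weighted_comp m \<phi> f1 z = \<mu> * f2 z - weighted_comp m \<phi> f2 z"
      and z: "z \<in> ball 0 1" for f1 f2 z
    proof -
      let ?g = "\<lambda>z. \<mu> * f2 z - weighted_comp m \<phi> f2 z"
      have "(f1 \<circ> Psi \<alpha>) (Psi \<alpha> z) = (f2 \<circ> Psi \<alpha>) (Psi \<alpha> z)"
      proof (rule uniq[OF \<mu> _ _ _ _ Psi_in_disc[OF \<alpha> z], where g = "?g \<circ> Psi \<alpha>"])
        show "\<forall>z\<in>ball 0 1. \<mu> * (f1 \<circ> Psi \<alpha>) z - 1 * (M z * (f1 \<circ> Psi \<alpha>) (\<beta> * z)) = (?g \<circ> Psi \<alpha>) z"
          using eq unfolding weighted_comp_eq_rotation .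
        show "\<forall>z\<in>ball 0 1. \<mu> * (f2 \<circ> Psi \<alpha>) z - 1 * (M z * (f2 \<circ> Psi \<alpha>) (\<beta> * z)) = (?g \<circ> Psi \<alpha>) z"
          unfolding weighted_comp_eq_rotation[symmetric] by simp
      qed (use f in \<open>auto intro!: holomorphic_comp_Psi[OF \<alpha>] simp: hol_disc_def simp del: o_apply\<close>)
      then show ?thesis using Psi_Psi[OF \<alpha> z] by simp
    qed
    ultimately show "\<mu> \<in> resolvent_set (weighted_comp m \<phi>)"
      unfolding resolvent_set_def by blast
  qed
  have "\<exists>C. \<forall>\<mu>\<in>cball l \<delta>. \<forall>f\<in>hol_disc.
      (\<forall>z\<in>ball 0 1. \<mu> * f z - weighted_comp m \<phi> f z = g z) \<longrightarrow>
      (\<forall>z. norm z \<le> r \<longrightarrow> norm (f z) \<le> C)" if g: "g \<in> hol_disc" and r: "0 < r" "r < 1" for g r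
  proof -
    obtain s where s: "0 < s" "s < 1" "\<And>z. norm z \<le> r \<Longrightarrow> norm (Psi \<alpha> z) \<le> s"
      using Psi_cball[OF \<alpha> r] by blast
    have "(g \<circ> Psi \<alpha>) holomorphic_on ball 0 1"
      using g holomorphic_comp_Psi[OF \<alpha>] by (simp add: hol_disc_def)
    from unif_solvableD[OF U this s(1,2)] obtain C where
      C: "\<And>a b. (a, b) \<in> (\<lambda>\<mu>. (\<mu>, 1)) ` cball l \<delta> \<Longrightarrow> \<exists>f. f holomorphic_on ball 0 1 \<and>
        (\<forall>z\<in>ball 0 1. a * f z - b * (M z * f (\<beta> * z)) = (g \<circ> Psi \<alpha>) z) \<and>
        (\<forall>z. norm z \<le> s \<longrightarrow> norm (f z) \<le> C)" by blast
    have "norm (f z) \<le> C" if \<mu>: "\<mu> \<in> cball l \<delta>" and f: "f \<in> hol_disc"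
      and eq: "\<forall>z\<in>ball 0 1. \<mu> * f z - weighted_comp m \<phi> f z = g z" and z: "norm z \<le> r" for \<mu> f z
    proof -
      obtain F where F: "F holomorphic_on ball 0 1"
        "\<forall>z\<in>ball 0 1. \<mu> * F z - 1 * (M z * F (\<beta> * z)) = (g \<circ> Psi \<alpha>) z"
        "\<forall>z. norm z \<le> s \<longrightarrow> norm (F z) \<le> C" using C[OF imageI[OF \<mu>]] by blast
      have zD: "z \<in> ball 0 1" using z r by simp
      have "(f \<circ> Psi \<alpha>) (Psi \<alpha> z) = F (Psi \<alpha> z)"
        using f
        by (intro uniq[OF \<mu> _ F(1) eq[unfolded weighted_comp_eq_rotation] F(2) Psi_in_disc[OF \<alpha> zD]]
            holomorphic_comp_Psi[OF \<alpha>]) (simp add: hol_disc_def)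
      then show ?thesis using F(3) s(3)[OF z] Psi_Psi[OF \<alpha> zD] by simp
    qed
    then show ?thesis by blast
  qed
  then show "l \<in> waelbroeck_resolvent_set (weighted_comp m \<phi>)"
    unfolding waelbroeck_resolvent_set_def using \<delta> res by fastforce
qed

lemma funpow_conjugate_rotation:
  "z \<in> ball 0 1 \<Longrightarrow> (\<phi> ^^ n) z = Psi \<alpha> (\<beta> ^ n * Psi \<alpha> z)"
proof (induction n)
  case 0
  then show ?case using Psi_Psi[OF \<alpha>] by simp
next
  case (Suc n)
  have "\<beta> ^ n * Psi \<alpha> z \<in> ball 0 1"
    using Psi_in_disc[OF \<alpha> Suc.prems] by (simp add: norm_mult norm_power \<beta>)
  then show ?case using Suc by (simp add: \<phi>_def Psi_Psi[OF \<alpha>] mult.assoc)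
qed

end

theorem theorem8p1:
  fixes \<alpha> \<beta> :: complex and m :: "complex \<Rightarrow> complex"
  defines "\<phi> \<equiv> Psi \<alpha> \<circ> (\<lambda>z. \<beta> * z) \<circ> Psi \<alpha>"
  assumes "norm \<alpha> < 1" and "norm \<beta> = 1" and "\<beta> \<noteq> 1"
    and "\<forall>n::nat. n \<ge> 1 \<longrightarrow> (\<exists>z\<in>ball 0 1. (\<phi> ^^ n) z \<noteq> z)"
    and "m holomorphic_on ball 0 1" and "\<exists>z\<in>ball 0 1. m z \<noteq> 0"
  shows "((\<forall>z\<in>ball 0 1. m z \<noteq> 0) \<longrightarrow>
            waelbroeck_spectrum (weighted_comp m \<phi>) = {l. norm l = norm (m \<alpha>)})
       \<and> ((\<exists>z0\<in>ball 0 1. m z0 = 0) \<longrightarrow>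
            ((\<exists>R>0. waelbroeck_spectrum (weighted_comp m \<phi>) = {l. norm l \<le> R})
             \<or> waelbroeck_spectrum (weighted_comp m \<phi>) = UNIV))"
proof -
  note \<alpha> = \<open>norm \<alpha> < 1\<close> and \<beta> = \<open>norm \<beta> = 1\<close> and m = \<open>m holomorphic_on ball 0 1\<close>
  define M where "M = m \<circ> Psi \<alpha>"
  let ?W = "waelbroeck_resolvent_set (weighted_comp m \<phi>)"
  have aper: "\<beta> ^ n \<noteq> 1" if "n \<ge> 1" for n :: nat
  proof
    \<comment> \<open>The \<open>n\<close>-th iterate of \<open>\<phi>\<close> is conjugate to
      rotation by \<open>\<beta> ^ n\<close>, so it would be the identity on the disc.\<close>
    assume "\<beta> ^ n = 1"
    then have "(\<phi> ^^ n) z = z" if "z \<in> ball 0 1" for z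
      using funpow_conjugate_rotation[OF \<alpha> \<beta> m that, folded \<phi>_def, of n] Psi_Psi[OF \<alpha> that] by simp
    then show False using assms(5) \<open>n \<ge> 1\<close> by blast
  qed
  have M: "M holomorphic_on ball 0 1" "M 0 = m \<alpha>"
    using holomorphic_M[OF \<alpha> \<beta> m] M_zero[OF \<alpha> \<beta> m] by (simp_all add: M_def)
  have nt: "\<exists>z\<in>ball 0 1. M z \<noteq> 0"
    using assms(7) Psi_in_disc[OF \<alpha>] Psi_Psi[OF \<alpha>] by (metis M_def comp_apply)
  note W = waelbroeck_resolvent_set_iff[OF \<alpha> \<beta> m, folded \<phi>_def M_def]
  show ?thesis
  proof (intro conjI impI)
    assume "\<forall>z\<in>ball 0 1. m z \<noteq> 0"
    then have "\<And>z. z \<in> ball 0 1 \<Longrightarrow> M z \<noteq> 0" using Psi_in_disc[OF \<alpha>] by (simp add: M_def)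
    then have "?W = {l. norm l \<noteq> norm (m \<alpha>)}"
      using rotation_resolvent_zero_free[OF M(1) nt \<beta> aper W] M(2) by simp
    then show "waelbroeck_spectrum (weighted_comp m \<phi>) = {l. norm l = norm (m \<alpha>)}"
      unfolding waelbroeck_spectrum_def by auto
  next
    assume "\<exists>z0\<in>ball 0 1. m z0 = 0"
    then have "\<exists>z0\<in>ball 0 1. M z0 = 0"
      using Psi_in_disc[OF \<alpha>] Psi_Psi[OF \<alpha>] by (metis M_def comp_apply)
    \<comment> \<open>Empty \<open>?W\<close> is the case of infinite radius.\<close>
    then have "(\<exists>R>0. ?W = {l. R < norm l}) \<or> ?W = {}"
      using rotation_resolvent_with_zero[OF M(1) nt \<beta> aper W] by simp
    moreover have "UNIV - {l. R < norm l} = {l :: complex. norm l \<le> R}" for R by auto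
    ultimately show "(\<exists>R>0. waelbroeck_spectrum (weighted_comp m \<phi>) = {l. norm l \<le> R})
        \<or> waelbroeck_spectrum (weighted_comp m \<phi>) = UNIV"
      unfolding waelbroeck_spectrum_def by (metis Diff_empty)
  qed
qed

end
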